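(* Let $G$ be a $\mathscr C_1^{(4)}$-hom-free $4$-graph on $n\ge1$ vertices. Then $e(G)<n^4/48$.
   Context: A $4$-graph is a $4$-uniform hypergraph; $e(G)$ is its number of edges. For $\ell>4$, the tight cycle $C_\ell^{(4)}$ has vertices $v_1,\dots,v_\ell$ and edges $\{v_i,v_{i+1},v_{i+2},v_{i+3}\}$, $1\le i\le\ell$ (indices mod $\ell$). A homomorphism $F\to G$ is a map $V(F)\to V(G)$ sending each edge of $F$ onto an edge of $G$. $G$ is $\mathscr C_1^{(4)}$-hom-free if there is no homomorphism $C_\ell^{(4)}\to G$ for any $\ell>4$ with $\ell\equiv1\pmod4$. *)

theory Defs
  imports Complex_Main
begin

definition four_graph :: "'a set \<Rightarrow> 'a set set \<Rightarrow> bool" where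
  "four_graph V E \<longleftrightarrow> finite V \<and> (\<forall>e\<in>E. e \<subseteq> V \<and> card e = 4)"

definition tight_cycle_hom :: "nat \<Rightarrow> 'a set \<Rightarrow> 'a set set \<Rightarrow> (nat \<Rightarrow> 'a) \<Rightarrow> bool" where
  "tight_cycle_hom l V E f \<longleftrightarrow>
     (\<forall>i<l. f i \<in> V) \<and>
     (\<forall>i<l. {f i, f ((i + 1) mod l), f ((i + 2) mod l), f ((i + 3) mod l)} \<in> E)"

definition C1_hom_free :: "'a set \<Rightarrow> 'a set set \<Rightarrow> bool" where
  "C1_hom_free V E \<longleftrightarrow>
     (\<forall>l. 4 < l \<and> l mod 4 = 1 \<longrightarrow> \<not> (\<exists>f. tight_cycle_hom l V E f))"

end

theory Submission
  imports Defs
begin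

text \<open>
  Call two vertices of an edge twins if they can be exchanged by a sequence of moves, each replacing one
  vertex of an ordered edge. A move can be carried out by a tight walk of length 4, so if all
  four vertices of an edge were twins, the cyclic shift of that edge would close up to a tight walk of length
  1 mod 4. Hence the twin classes of an edge have sizes 3+1, 2+2, 2+1+1 or 1+1+1+1, and two edges
  sharing three vertices have matching classes. In the link of a vertex \<open>a\<close> this gives every
  pair of vertices at most one label (undirected base, arc, apex, bare), and every edge of the link becomes a
  cherry (a base \<open>bc\<close> with arcs \<open>b \<rightarrow> d\<close>, \<open>c \<rightarrow> d\<close>), a triangle of apex pairs or
  a triangle of bare pairs.

  Averaging over \<open>a\<close> the edges of class sizes 3+1 yields a vertex \<open>a\<close> whose link has at most as many
  ordered apex triangles as cherries. For such a link on \<open>N = n - 1\<close> vertices, a Loomis-Whitney bound, a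
  codegree bound and a weak bound on the number of cherries alone show that the degree of \<open>a\<close> is at most
  \<open>N\<^sup>3/12\<close>. Deleting \<open>a\<close> and induction on \<open>n\<close> finish the proof, since
  \<open>(n-1)\<^sup>4/48 + (n-1)\<^sup>3/12 \<le> n\<^sup>4/48\<close>.
\<close>

subsection \<open>Twins\<close>

inductive conn :: "'a set set \<Rightarrow> 'a \<times> 'a \<times> 'a \<times> 'a \<Rightarrow> 'a \<times> 'a \<times> 'a \<times> 'a \<Rightarrow> bool"
  for E where
    refl: "{a, b, c, d} \<in> E \<Longrightarrow> conn E (a, b, c, d) (a, b, c, d)"
  | step1: "conn E t (a, b, c, d) \<Longrightarrow> {x, b, c, d} \<in> E \<Longrightarrow> conn E t (x, b, c, d)"
  | step2: "conn E t (a, b, c, d) \<Longrightarrow> {a, x, c, d} \<in> E \<Longrightarrow> conn E t (a, x, c, d)"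
  | step3: "conn E t (a, b, c, d) \<Longrightarrow> {a, b, x, d} \<in> E \<Longrightarrow> conn E t (a, b, x, d)"
  | step4: "conn E t (a, b, c, d) \<Longrightarrow> {a, b, c, x} \<in> E \<Longrightarrow> conn E t (a, b, c, x)"

lemma conn_edge:
  assumes "conn E t (a, b, c, d)"
  shows "{a, b, c, d} \<in> E"
  using assms by (cases rule: conn.cases) auto

lemma conn_trans:
  assumes "conn E u v" "conn E t u"
  shows "conn E t v"
  using assms by (induction rule: conn.induct) (auto intro: conn.intros)

lemma conn_sym:
  assumes "conn E t u"
  shows "conn E u t"
  using assms
proof (induction rule: conn.induct)
  case (refl a b c d)
  then show ?case by (rule conn.refl)
next
  case (step1 t a b c d x)
  have "conn E (x, b, c, d) (a, b, c, d)"
    using conn.step1[OF conn.refl[OF step1(2)] conn_edge[OF step1(1)]] .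
  then show ?case using step1(3) conn_trans by blast
next
  case (step2 t a b c d x)
  have "conn E (a, x, c, d) (a, b, c, d)"
    using conn.step2[OF conn.refl[OF step2(2)] conn_edge[OF step2(1)]] .
  then show ?case using step2(3) conn_trans by blast
next
  case (step3 t a b c d x)
  have "conn E (a, b, x, d) (a, b, c, d)"
    using conn.step3[OF conn.refl[OF step3(2)] conn_edge[OF step3(1)]] .
  then show ?case using step3(3) conn_trans by blast
next
  case (step4 t a b c d x)
  have "conn E (a, b, c, x) (a, b, c, d)"
    using conn.step4[OF conn.refl[OF step4(2)] conn_edge[OF step4(1)]] .
  then show ?case using step4(3) conn_trans by blast
qed

text \<open>An edge is a set, so a chain of moves survives any permutation of positions applied to
  both of its ends. This swap and the next two generate all such permutations.\<close>

lemma conn_swap12: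
  assumes "conn E (a, b, c, d) (a', b', c', d')"
  shows "conn E (b, a, c, d) (b', a', c', d')"
  using assms
  by (induction "(a, b, c, d)" "(a', b', c', d')" arbitrary: a' b' c' d' rule: conn.induct)
    (auto intro: conn.intros simp: insert_commute)

lemma conn_swap23:
  assumes "conn E (a, b, c, d) (a', b', c', d')"
  shows "conn E (a, c, b, d) (a', c', b', d')"
  using assms
  by (induction "(a, b, c, d)" "(a', b', c', d')" arbitrary: a' b' c' d' rule: conn.induct)
    (auto intro: conn.intros simp: insert_commute)

lemma conn_swap34:
  assumes "conn E (a, b, c, d) (a', b', c', d')"
  shows "conn E (a, b, d, c) (a', b', d', c')"
  using assms
  by (induction "(a, b, c, d)" "(a', b', c', d')" arbitrary: a' b' c' d' rule: conn.induct)
    (auto intro: conn.intros simp: insert_commute)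

text \<open>Vertices \<open>a\<close> and \<open>b\<close> are twins in the edge \<open>abcd\<close> if their positions can be exchanged by replacing one
  vertex of an ordered edge at a time. This is an equivalence relation on each edge, and it is preserved
  when a new vertex takes over the position of an old one.\<close>

definition twin :: "'a set set \<Rightarrow> 'a \<Rightarrow> 'a \<Rightarrow> 'a \<Rightarrow> 'a \<Rightarrow> bool" where
  "twin E a b c d \<longleftrightarrow> conn E (a, b, c, d) (b, a, c, d)"

lemma twin_edge: "twin E a b c d \<Longrightarrow> {a, b, c, d} \<in> E"
  unfolding twin_def using conn_edge insert_commute by metis

lemma twin_sym: "twin E a b c d \<longleftrightarrow> twin E b a c d"
  unfolding twin_def using conn_sym by blast

lemma twin_swap: "twin E a b c d \<longleftrightarrow> twin E a b d c"
  unfolding twin_def by (blast intro: conn_swap34)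

text \<open>The transposition of \<open>a\<close> and \<open>c\<close> is that of \<open>b\<close>
  and \<open>c\<close> conjugated by that of \<open>a\<close> and \<open>b\<close>; the three chains
  carry out these exchanges in turn.\<close>

lemma twin_trans:
  assumes "twin E a b c d" "twin E b c a d"
  shows "twin E a c b d"
proof -
  have "conn E (a, c, b, d) (b, c, a, d)"
    using assms(1) unfolding twin_def by (rule conn_swap23)
  moreover have "conn E (b, c, a, d) (c, b, a, d)"
    using assms(2) unfolding twin_def .
  moreover have "conn E (c, b, a, d) (c, a, b, d)"
    using conn_sym[OF conn_swap12[OF conn_swap23[OF assms(1)[unfolded twin_def]]]] .
  ultimately show ?thesis unfolding twin_def using conn_trans by blast
qed

text \<open>Put \<open>d\<close> in the place of \<open>x\<close>, exchange \<open>a\<close> and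
  \<open>b\<close>, then put \<open>x\<close> back.\<close>

lemma twin_replace_other:
  assumes "twin E a b c d" "{a, b, c, x} \<in> E"
  shows "twin E a b c x"
proof -
  have "conn E (a, b, c, x) (a, b, c, d)"
    using conn.step4[OF conn.refl[OF assms(2)] twin_edge[OF assms(1)]] .
  moreover have "conn E (a, b, c, d) (b, a, c, d)"
    using assms(1) unfolding twin_def .
  moreover have "conn E (b, a, c, d) (b, a, c, x)"
    using conn.step4[OF conn.refl, of b a c d E x] twin_edge[OF assms(1)] assms(2)
    by (simp add: insert_commute)
  ultimately show ?thesis unfolding twin_def by (meson conn_trans)
qed

text \<open>Here \<open>d\<close> stands in for \<open>x\<close>: after its exchange with
  \<open>a\<close> it occupies the other position, where \<open>x\<close> takes over again.\<close>

lemma twin_replace_self: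
  assumes "twin E a d b c" "{a, b, c, x} \<in> E"
  shows "twin E a x b c"
proof -
  have e: "{a, x, b, c} \<in> E" "{x, a, b, c} \<in> E" "{d, a, b, c} \<in> E"
    using assms(2) twin_edge[OF assms(1)] by (simp_all add: insert_commute)
  have "conn E (a, x, b, c) (a, d, b, c)"
    using conn.step2[OF conn.refl[OF e(1)] twin_edge[OF assms(1)]] .
  moreover have "conn E (a, d, b, c) (d, a, b, c)"
    using assms(1) unfolding twin_def .
  moreover have "conn E (d, a, b, c) (x, a, b, c)"
    using conn.step1[OF conn.refl[OF e(3)] e(2)] .
  ultimately show ?thesis unfolding twin_def by (meson conn_trans)
qed

text \<open>There is one representative for each of the six pairs in an edge. After this rewriting,
  case analyses on twin classes are purely propositional.\<close>

lemma twin_normal: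
  "twin E b a c d = twin E a b c d" "twin E a b d c = twin E a b c d" "twin E b a d c = twin E a b c d"
  "twin E c a b d = twin E a c b d" "twin E a c d b = twin E a c b d" "twin E c a d b = twin E a c b d"
  "twin E d a b c = twin E a d b c" "twin E a d c b = twin E a d b c" "twin E d a c b = twin E a d b c"
  "twin E c b a d = twin E b c a d" "twin E b c d a = twin E b c a d" "twin E c b d a = twin E b c a d"
  "twin E d b a c = twin E b d a c" "twin E b d c a = twin E b d a c" "twin E d b c a = twin E b d a c"
  "twin E d c a b = twin E c d a b" "twin E c d b a = twin E c d a b" "twin E d c b a = twin E c d a b"
  using twin_sym twin_swap by metis+

text \<open>Edges sharing three vertices have the same twin classes, with \<open>y\<close> in the
  role of \<open>x\<close>. Thus a shape found on one edge passes to every edge through the same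
  three vertices.\<close>

lemma twin_replace:
  assumes "{a, b, c, x} \<in> E" "{a, b, c, y} \<in> E"
  shows "twin E a b c x = twin E a b c y" "twin E a c b x = twin E a c b y"
    "twin E b c a x = twin E b c a y" "twin E a x b c = twin E a y b c"
    "twin E b x a c = twin E b y a c" "twin E c x a b = twin E c y a b"
proof -
  have 1: "twin E a b c x = twin E a b c y" "twin E a x b c = twin E a y b c"
    if "{a, b, c, x} \<in> E" "{a, b, c, y} \<in> E" for a b c x y
    using that twin_replace_other twin_replace_self by metis+
  have "{a, c, b, x} \<in> E" "{a, c, b, y} \<in> E" "{b, c, a, x} \<in> E" "{b, c, a, y} \<in> E"
    "{b, a, c, x} \<in> E" "{b, a, c, y} \<in> E" "{c, a, b, x} \<in> E" "{c, a, b, y} \<in> E"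
    using assms by (simp_all add: insert_commute)
  then show "twin E a b c x = twin E a b c y" "twin E a c b x = twin E a c b y"
    "twin E b c a x = twin E b c a y" "twin E a x b c = twin E a y b c"
    "twin E b x a c = twin E b y a c" "twin E c x a b = twin E c y a b"
    using 1 assms by blast+
qed

text \<open>The three kinds of edges, by the sizes of their twin classes: \<open>pointed\<close> is 3+1, with the odd vertex last;
  \<open>matched\<close> is 2+2 or 2+1+1, where in the second case the two vertices without a twin count as
  partners; \<open>twinless\<close> is 1+1+1+1. The kind, with all four vertices twins, is the one that
  hom-freeness excludes.\<close>

definition pointed :: "'a set set \<Rightarrow> 'a \<Rightarrow> 'a \<Rightarrow> 'a \<Rightarrow> 'a \<Rightarrow> bool" where
  "pointed E a b c d \<longleftrightarrow> {a, b, c, d} \<in> E \<and> twin E a b c d \<and> twin E b c a d"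

definition matched :: "'a set set \<Rightarrow> 'a \<Rightarrow> 'a \<Rightarrow> 'a \<Rightarrow> 'a \<Rightarrow> bool" where
  "matched E a b c d \<longleftrightarrow> {a, b, c, d} \<in> E \<and> (twin E a b c d \<or> twin E c d a b) \<and>
    \<not> twin E a c b d \<and> \<not> twin E a d b c \<and> \<not> twin E b c a d \<and> \<not> twin E b d a c"

definition twinless :: "'a set set \<Rightarrow> 'a \<Rightarrow> 'a \<Rightarrow> 'a \<Rightarrow> 'a \<Rightarrow> bool" where
  "twinless E a b c d \<longleftrightarrow> {a, b, c, d} \<in> E \<and> \<not> twin E a b c d \<and> \<not> twin E c d a b \<and>
    \<not> twin E a c b d \<and> \<not> twin E a d b c \<and> \<not> twin E b c a d \<and> \<not> twin E b d a c"

text \<open>In the link of \<open>a\<close>, both a pointed edge with point \<open>d \<noteq> a\<close> and a matched edge in which \<open>d\<close> is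
  the partner of \<open>a\<close> are drawn as an undirected base \<open>bc\<close> and two arcs into the sink \<open>d\<close>.\<close>

definition cherry :: "'a set set \<Rightarrow> 'a \<Rightarrow> 'a \<Rightarrow> 'a \<Rightarrow> 'a \<Rightarrow> bool" where
  "cherry E a b c d \<longleftrightarrow> pointed E a b c d \<or> matched E a d b c"

section \<open>Shapes of an edge seen from one of its vertices\<close>

definition no_full :: "'a set set \<Rightarrow> bool" where
  "no_full E \<longleftrightarrow> (\<forall>a b c d. \<not> (twin E a b c d \<and> twin E b c a d \<and> twin E c d a b))"

text \<open>The shape is read off from the class sizes. In 3+1 either \<open>a\<close> is the point,
  or the point is the sink of a cherry. In 2+2 and 2+1+1 the partner of \<open>a\<close> is the
  sink. In 1+1+1+1 the edge is twinless.\<close>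

lemma edge_types:
  assumes "{a, b, c, d} \<in> E" "no_full E"
  shows "cherry E a b c d \<or> cherry E a c d b \<or> cherry E a b d c \<or> pointed E b c d a \<or> twinless E a b c d"
proof -
  note n = twin_normal[where E=E and a=a and b=b and c=c and d=d]
  note t = twin_trans[of E a b c d] twin_trans[of E b a c d] twin_trans[of E a c b d]
    twin_trans[of E a b d c] twin_trans[of E b a d c] twin_trans[of E a d b c]
    twin_trans[of E a c d b] twin_trans[of E c a d b] twin_trans[of E a d c b]
    twin_trans[of E b c d a] twin_trans[of E c b d a] twin_trans[of E b d c a]
  have e: "{a, c, d, b} \<in> E" "{a, b, d, c} \<in> E" "{b, c, d, a} \<in> E" "{a, d, b, c} \<in> E"
    "{a, b, c, d} \<in> E" "{a, c, b, d} \<in> E" "{a, b, c, d} \<in> E" "{a, c, b, d} \<in> E"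
    using assms by (simp_all add: insert_commute)
  show ?thesis
    using t e unfolding cherry_def pointed_def matched_def twinless_def n by argo
qed

lemma pointed_replace:
  assumes "pointed E a b c x" "{a, b, c, y} \<in> E"
  shows "pointed E a b c y"
proof -
  have "{a, b, c, x} \<in> E" using assms(1) unfolding pointed_def by blast
  from twin_replace[OF this assms(2)] show ?thesis
    using assms unfolding pointed_def by simp
qed

lemma pointed_replace':
  assumes "pointed E a b x c" "{a, b, c, y} \<in> E"
  shows "pointed E a b y c"
proof -
  have "{a, b, c, x} \<in> E" "{a, b, y, c} \<in> E"
    using assms unfolding pointed_def by (simp_all add: insert_commute)
  with twin_replace[OF this(1) assms(2)] assms show ?thesis
    unfolding pointed_def by (simp add: twin_normal[where E=E and a=a and b=b and c=c and d=x]
      twin_normal[where E=E and a=a and b=b and c=c and d=y])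
qed

lemma matched_replace:
  assumes "matched E a b c x" "{a, b, c, y} \<in> E"
  shows "matched E a b c y"
proof -
  have "{a, b, c, x} \<in> E" using assms(1) unfolding matched_def by blast
  from twin_replace[OF this assms(2)] show ?thesis
    using assms unfolding matched_def
    by (simp add: twin_normal[where E=E and a=a and b=b and c=c and d=x]
      twin_normal[where E=E and a=a and b=b and c=c and d=y])
qed

lemma pointed_perm:
  assumes "pointed E a b c d"
  shows "pointed E b a c d" "pointed E a c b d" "pointed E b c a d" "pointed E c a b d" "pointed E c b a d"
proof -
  note n = twin_normal[where E=E and a=a and b=b and c=c and d=d]
  have "{b, a, c, d} \<in> E" "{a, c, b, d} \<in> E" "{b, c, a, d} \<in> E" "{c, a, b, d} \<in> E" "{c, b, a, d} \<in> E"
    using assms unfolding pointed_def by (simp_all add: insert_commute)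
  then show "pointed E b a c d" "pointed E a c b d" "pointed E b c a d" "pointed E c a b d" "pointed E c b a d"
    using assms twin_trans[of E a b c d] unfolding pointed_def n by blast+
qed

lemma matched_perm:
  assumes "matched E a b c d"
  shows "matched E b a c d" "matched E a b d c" "matched E c d a b"
proof -
  note n = twin_normal[where E=E and a=a and b=b and c=c and d=d]
  have "{b, a, c, d} \<in> E" "{a, b, d, c} \<in> E" "{c, d, a, b} \<in> E"
    using assms unfolding matched_def by (simp_all add: insert_commute)
  then show "matched E b a c d" "matched E a b d c" "matched E c d a b"
    using assms unfolding matched_def n by blast+
qed

lemma twinless_perm:
  assumes "twinless E a b c d"
  shows "twinless E b a c d" "twinless E a c b d" "twinless E a b d c"
proof -
  note n = twin_normal[where E=E and a=a and b=b and c=c and d=d]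
  have "{b, a, c, d} \<in> E" "{a, c, b, d} \<in> E" "{a, b, d, c} \<in> E"
    using assms unfolding twinless_def by (simp_all add: insert_commute)
  then show "twinless E b a c d" "twinless E a c b d" "twinless E a b d c"
    using assms unfolding twinless_def n by blast+
qed

lemma cherry_commute: "cherry E a b c d \<longleftrightarrow> cherry E a c b d"
  unfolding cherry_def by (blast intro: pointed_perm(2) matched_perm(2))

lemma cherry_edge: "cherry E a b c d \<Longrightarrow> {a, b, c, d} \<in> E"
  unfolding cherry_def pointed_def matched_def by (auto simp: insert_commute)

text \<open>Once \<open>bc\<close> is a base in the link of \<open>a\<close>, every link triangle on
  \<open>bc\<close> is a cherry over it. With its companion for arcs below, this makes labels of
  pairs independent of the triangle chosen.\<close>

lemma cherry_replace_sink:
  assumes "cherry E a b c x" "{a, b, c, y} \<in> E"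
  shows "cherry E a b c y"
proof -
  have "{b, c, a, y} \<in> E" using assms(2) by (simp add: insert_commute)
  then show ?thesis
    using assms pointed_replace matched_replace matched_perm(3) unfolding cherry_def by metis
qed

lemma cherry_replace_base:
  assumes "cherry E a b x c" "{a, b, c, y} \<in> E"
  shows "cherry E a b y c"
proof -
  have "{a, c, b, y} \<in> E" using assms(2) by (simp add: insert_commute)
  then show ?thesis
    using assms pointed_replace' matched_replace unfolding cherry_def by metis
qed

text \<open>Two of these shapes on one edge either contradict each other about a single twin pair or
  make all four vertices twins. The latter happens when two pointed shapes with different points
  meet.\<close>

lemma types_exclusive:
  assumes "no_full E"
  shows "\<not> (cherry E a b c d \<and> cherry E a b d c)" "\<not> (cherry E a b c d \<and> pointed E b c d a)"
    "\<not> (cherry E a b c d \<and> twinless E a b c d)" "\<not> (pointed E b c d a \<and> twinless E a b c d)"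
    "\<not> (cherry E a b d c \<and> cherry E a c d b)"
    "\<not> (cherry E a b d c \<and> pointed E b c d a)" "\<not> (cherry E a b d c \<and> twinless E a b c d)"
proof -
  note n = twin_normal[where E=E and a=a and b=b and c=c and d=d]
  note t = twin_trans[of E a b c d] twin_trans[of E b a c d] twin_trans[of E a c b d]
    twin_trans[of E a b d c] twin_trans[of E b a d c] twin_trans[of E a d b c]
    twin_trans[of E a c d b] twin_trans[of E c a d b] twin_trans[of E a d c b]
    twin_trans[of E b c d a] twin_trans[of E c b d a] twin_trans[of E b d c a]
  have f: "\<not> (twin E a b c d \<and> twin E b c a d \<and> twin E c d a b)"
    using assms unfolding no_full_def by blast
  show "\<not> (cherry E a b c d \<and> cherry E a b d c)" "\<not> (cherry E a b c d \<and> pointed E b c d a)"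
    "\<not> (cherry E a b c d \<and> twinless E a b c d)" "\<not> (pointed E b c d a \<and> twinless E a b c d)"
    "\<not> (cherry E a b d c \<and> cherry E a c d b)"
    "\<not> (cherry E a b d c \<and> pointed E b c d a)" "\<not> (cherry E a b d c \<and> twinless E a b c d)"
    using t f unfolding cherry_def pointed_def matched_def twinless_def n by sat+
qed

section \<open>Labels on the pairs of a link\<close>

definition base :: "'a set set \<Rightarrow> 'a \<Rightarrow> 'a \<Rightarrow> 'a \<Rightarrow> bool" where
  "base E a b c \<longleftrightarrow> (\<exists>x. cherry E a b c x)"

definition arc :: "'a set set \<Rightarrow> 'a \<Rightarrow> 'a \<Rightarrow> 'a \<Rightarrow> bool" where
  "arc E a b c \<longleftrightarrow> (\<exists>x. cherry E a b x c)"

definition apex :: "'a set set \<Rightarrow> 'a \<Rightarrow> 'a \<Rightarrow> 'a \<Rightarrow> bool" where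
  "apex E a b c \<longleftrightarrow> (\<exists>x. pointed E b c x a)"

definition bare :: "'a set set \<Rightarrow> 'a \<Rightarrow> 'a \<Rightarrow> 'a \<Rightarrow> bool" where
  "bare E a b c \<longleftrightarrow> (\<exists>x. twinless E a b c x)"

lemma base_commute: "base E a b c \<longleftrightarrow> base E a c b"
  unfolding base_def using cherry_commute by metis

lemma apex_commute: "apex E a b c \<longleftrightarrow> apex E a c b"
  unfolding apex_def by (blast intro: pointed_perm(1))

lemma bare_commute: "bare E a b c \<longleftrightarrow> bare E a c b"
  unfolding bare_def by (blast intro: twinless_perm(2))

text \<open>Let two labels of \<open>bc\<close> be witnessed by third vertices \<open>x\<close> and
  \<open>y\<close>. The first shape can be carried over from \<open>x\<close> to \<open>y\<close>,
  and then the edge \<open>abcy\<close> has two incompatible shapes.\<close>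

lemma link_exclusive:
  assumes "no_full E"
  shows "\<not> (base E a b c \<and> arc E a b c)" "\<not> (base E a b c \<and> arc E a c b)"
    "\<not> (base E a b c \<and> apex E a b c)" "\<not> (base E a b c \<and> bare E a b c)"
    "\<not> (arc E a b c \<and> arc E a c b)" "\<not> (arc E a b c \<and> apex E a b c)"
    "\<not> (arc E a c b \<and> apex E a b c)" "\<not> (arc E a b c \<and> bare E a b c)"
    "\<not> (arc E a c b \<and> bare E a b c)" "\<not> (apex E a b c \<and> bare E a b c)"
proof -
  have ba: False if "cherry E a b c x" "cherry E a b y c" for b c x y
  proof -
    have "{a, b, c, y} \<in> E" using cherry_edge[OF that(2)] by (simp add: insert_commute)
    from cherry_replace_sink[OF that(1) this] that(2) types_exclusive(1)[OF assms] show False by blast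
  qed
  have ap: False if "cherry E a b x c" "pointed E b c y a" for b c x y
  proof -
    have "{a, b, c, y} \<in> E" using that(2) unfolding pointed_def by (simp add: insert_commute)
    from cherry_replace_base[OF that(1) this] that(2) types_exclusive(6)[OF assms] show False by blast
  qed
  have an: False if "cherry E a b x c" "twinless E a b c y" for b c x y
  proof -
    have "{a, b, c, y} \<in> E" using that(2) unfolding twinless_def by blast
    from cherry_replace_base[OF that(1) this] that(2) types_exclusive(7)[OF assms] show False by blast
  qed
  show "\<not> (base E a b c \<and> arc E a b c)"
    using ba unfolding base_def arc_def by blast
  have "\<not> (base E a c b \<and> arc E a c b)"
    using ba unfolding base_def arc_def by blast
  then show "\<not> (base E a b c \<and> arc E a c b)"
    using base_commute[of E a b c] by blast
  show "\<not> (base E a b c \<and> apex E a b c)"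
  proof
    assume "base E a b c \<and> apex E a b c"
    then obtain x y where xy: "cherry E a b c x" "pointed E b c y a"
      unfolding base_def apex_def by blast
    have "{a, b, c, y} \<in> E" using xy(2) unfolding pointed_def by (simp add: insert_commute)
    from cherry_replace_sink[OF xy(1) this] xy(2) types_exclusive(2)[OF assms] show False by blast
  qed
  show "\<not> (base E a b c \<and> bare E a b c)"
  proof
    assume "base E a b c \<and> bare E a b c"
    then obtain x y where xy: "cherry E a b c x" "twinless E a b c y"
      unfolding base_def bare_def by blast
    have "{a, b, c, y} \<in> E" using xy(2) unfolding twinless_def by blast
    from cherry_replace_sink[OF xy(1) this] xy(2) types_exclusive(3)[OF assms] show False by blast
  qed
  show "\<not> (arc E a b c \<and> arc E a c b)"
  proof
    assume "arc E a b c \<and> arc E a c b"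
    then obtain x y where xy: "cherry E a b x c" "cherry E a c y b" unfolding arc_def by blast
    have "{a, b, c, y} \<in> E" using cherry_edge[OF xy(2)] by (simp add: insert_commute)
    from cherry_replace_base[OF xy(1) this] xy(2) types_exclusive(5)[OF assms] show False by blast
  qed
  show "\<not> (arc E a b c \<and> apex E a b c)" "\<not> (arc E a b c \<and> bare E a b c)"
    using ap an unfolding arc_def apex_def bare_def by blast+
  have "\<not> (arc E a c b \<and> apex E a c b)" "\<not> (arc E a c b \<and> bare E a c b)"
    using ap an unfolding arc_def apex_def bare_def by blast+
  then show "\<not> (arc E a c b \<and> apex E a b c)" "\<not> (arc E a c b \<and> bare E a b c)"
    using apex_commute[of E a b c] bare_commute[of E a b c] by simp_all
  show "\<not> (apex E a b c \<and> bare E a b c)"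
  proof
    assume "apex E a b c \<and> bare E a b c"
    then obtain x y where xy: "pointed E b c x a" "twinless E a b c y"
      unfolding apex_def bare_def by blast
    have "{b, c, a, y} \<in> E" using xy(2) unfolding twinless_def by (simp add: insert_commute)
    from pointed_replace'[OF xy(1) this] xy(2) types_exclusive(4)[OF assms] show False by blast
  qed
qed

text \<open>The vertex \<open>x\<close> serves as a spare: it replaces \<open>d\<close>, then
  \<open>d\<close> replaces \<open>b\<close>, then \<open>b\<close> replaces \<open>x\<close>. This
  exchanges \<open>b\<close> and \<open>d\<close>, so they would be twins.\<close>

lemma twinless_codegree:
  assumes "twinless E a b c d" "twinless E a b c x" "twinless E a c d x"
  shows False
proof -
  have e: "{a, b, c, d} \<in> E" "{a, b, c, x} \<in> E" "{a, d, c, x} \<in> E" "{a, d, c, b} \<in> E"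
    using assms unfolding twinless_def by (simp_all add: insert_commute)
  have "conn E (a, b, c, d) (a, d, c, b)"
    using conn.step4[OF conn.step2[OF conn.step4[OF conn.refl[OF e(1)] e(2)] e(3)] e(4)] .
  then have "conn E (b, a, d, c) (d, a, b, c)"
    by (rule conn_swap34[OF conn_swap12])
  then have "twin E b d a c"
    unfolding twin_def by (rule conn_swap23)
  with assms(1) show False unfolding twinless_def by blast
qed

subsection \<open>Tight walks\<close>

definition shift :: "'a set set \<Rightarrow> 'a \<times> 'a \<times> 'a \<times> 'a \<Rightarrow> 'a \<times> 'a \<times> 'a \<times> 'a \<Rightarrow> bool" where
  "shift E t u \<longleftrightarrow> (\<exists>a b c d e. t = (a, b, c, d) \<and> u = (b, c, d, e) \<and> {a, b, c, d} \<in> E \<and> {b, c, d, e} \<in> E)"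

lemma shift_four:
  assumes "{a, b, c, d} \<in> E" "{b, c, d, e} \<in> E" "{c, d, e, f} \<in> E" "{d, e, f, g} \<in> E" "{e, f, g, h} \<in> E"
  shows "(shift E ^^ 4) (a, b, c, d) (e, f, g, h)"
proof -
  have "(shift E ^^ Suc (Suc (Suc (Suc 0)))) (a, b, c, d) (e, f, g, h)"
    by (intro relpowp_Suc_I[of _ _ _ "(d, e, f, g)"] relpowp_Suc_I[of _ _ _ "(c, d, e, f)"]
        relpowp_Suc_I[of _ _ _ "(b, c, d, e)"] relpowp_Suc_I[of _ _ _ "(a, b, c, d)"])
      (use assms in \<open>auto simp: shift_def\<close>)
  then show ?thesis by (simp add: numeral_eq_Suc)
qed

text \<open>Write the ordered edges before and after a move one behind the other, as in
  \<open>a b c d x b c d\<close>. Every window of four consecutive vertices is one of the two edges,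
  so four shifts perform the move.\<close>

lemma conn_shift:
  assumes "conn E t u"
  shows "\<exists>k. (shift E ^^ (4 * k)) t u"
  using assms
proof (induction rule: conn.induct)
  case (refl a b c d)
  have "(shift E ^^ (4 * 0)) (a, b, c, d) (a, b, c, d)" by simp
  then show ?case by blast
next
  case (step1 t a b c d x)
  then obtain k where k: "(shift E ^^ (4 * k)) t (a, b, c, d)" by blast
  have "(shift E ^^ 4) (a, b, c, d) (x, b, c, d)"
    using conn_edge[OF step1(1)] step1(2) by (intro shift_four) (simp_all add: insert_commute)
  with k have "(shift E ^^ (4 * k + 4)) t (x, b, c, d)" by (auto simp: relpowp_add)
  then show ?case by (metis mult_Suc_right add.commute)
next
  case (step2 t a b c d x)
  then obtain k where k: "(shift E ^^ (4 * k)) t (a, b, c, d)" by blast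
  have "(shift E ^^ 4) (a, b, c, d) (a, x, c, d)"
    using conn_edge[OF step2(1)] step2(2) by (intro shift_four) (simp_all add: insert_commute)
  with k have "(shift E ^^ (4 * k + 4)) t (a, x, c, d)" by (auto simp: relpowp_add)
  then show ?case by (metis mult_Suc_right add.commute)
next
  case (step3 t a b c d x)
  then obtain k where k: "(shift E ^^ (4 * k)) t (a, b, c, d)" by blast
  have "(shift E ^^ 4) (a, b, c, d) (a, b, x, d)"
    using conn_edge[OF step3(1)] step3(2) by (intro shift_four) (simp_all add: insert_commute)
  with k have "(shift E ^^ (4 * k + 4)) t (a, b, x, d)" by (auto simp: relpowp_add)
  then show ?case by (metis mult_Suc_right add.commute)
next
  case (step4 t a b c d x)
  then obtain k where k: "(shift E ^^ (4 * k)) t (a, b, c, d)" by blast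
  have "(shift E ^^ 4) (a, b, c, d) (a, b, c, x)"
    using conn_edge[OF step4(1)] step4(2) by (intro shift_four) (simp_all add: insert_commute)
  with k have "(shift E ^^ (4 * k + 4)) t (a, b, c, x)" by (auto simp: relpowp_add)
  then show ?case by (metis mult_Suc_right add.commute)
qed

lemma closed_walk_hom:
  assumes "four_graph V E" "(shift E ^^ L) t t" "0 < L"
  shows "\<exists>f. tight_cycle_hom L V E f"
proof -
  from assms(2) obtain g where g: "g 0 = t" "g L = t" "\<And>i. i < L \<Longrightarrow> shift E (g i) (g (Suc i))"
    by (auto simp: relpowp_fun_conv)
  \<comment> \<open>The closed walk is continued periodically, so that indices need no reduction
    modulo \<open>L\<close> below.\<close>
  define G where "G i = g (i mod L)" for i
  have G: "shift E (G i) (G (Suc i))" for i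
  proof (cases "Suc (i mod L) = L")
    case True
    then have "Suc i mod L = 0" by (simp add: mod_Suc)
    moreover have "i mod L < L" using assms(3) by simp
    ultimately show ?thesis unfolding G_def using g True by metis
  next
    case False
    then have "Suc i mod L = Suc (i mod L)" by (simp add: mod_Suc)
    then show ?thesis unfolding G_def using g(3) assms(3) by simp
  qed
  \<comment> \<open>Consecutive tuples overlap in three entries, so the first coordinates determine
    the whole walk.\<close>
  define f where "f i = fst (G i)" for i
  have four: "G i = (f i, f (Suc i), f (Suc (Suc i)), f (Suc (Suc (Suc i))))" for i
    using G[of i] G[of "Suc i"] G[of "Suc (Suc i)"] unfolding shift_def f_def by auto
  have period: "f (i mod L) = f i" for i
    unfolding f_def G_def by simp
  have edge: "{f i, f (Suc i), f (Suc (Suc i)), f (Suc (Suc (Suc i)))} \<in> E" for i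
    using G[of i] four[of i] unfolding shift_def by auto
  have "f i \<in> V" for i
    using edge[of i] assms(1) unfolding four_graph_def by blast
  moreover have "{f i, f ((i + 1) mod L), f ((i + 2) mod L), f ((i + 3) mod L)} \<in> E" for i
    using edge[of i] unfolding period by (simp add: numeral_eq_Suc)
  ultimately show ?thesis unfolding tight_cycle_hom_def by blast
qed

lemma hom_free_no_full:
  assumes "four_graph V E" "C1_hom_free V E"
  shows "no_full E"
  unfolding no_full_def
proof (intro allI notI)
  fix a b c d
  assume t: "twin E a b c d \<and> twin E b c a d \<and> twin E c d a b"
  note n = twin_normal[where E=E and a=a and b=b and c=c and d=d]
  have ac: "twin E a c b d" using t twin_trans[of E a b c d] by blast
  have ad: "twin E a d b c"
    using twin_trans[of E a c d b] ac t unfolding n by simp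
  \<comment> \<open>Exchanging \<open>a\<close> with \<open>b\<close>, then \<open>c\<close>, then
    \<open>d\<close> moves it from the first position to the last, which is the cyclic shift of the
    edge.\<close>
  have c1: "conn E (a, b, c, d) (b, a, c, d)"
    using t unfolding twin_def by simp
  have c2: "conn E (b, a, c, d) (b, c, a, d)"
    using conn_swap12[OF conn_swap23[OF ac[unfolded twin_def]]] .
  have c3: "conn E (b, c, a, d) (b, c, d, a)"
    using conn_swap23[OF conn_swap12[OF conn_swap34[OF conn_swap23[OF ad[unfolded twin_def]]]]] .
  have "conn E (b, c, d, a) (a, b, c, d)"
    by (rule conn_sym[OF conn_trans[OF c3 conn_trans[OF c2 c1]]])
  then obtain k where k: "(shift E ^^ (4 * k)) (b, c, d, a) (a, b, c, d)" by (auto dest: conn_shift)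
  have e: "{a, b, c, d} \<in> E" using t twin_edge[of E a b c d] by simp
  \<comment> \<open>One extra turn around the edge makes the length exceed 4 even when
    \<open>k = 0\<close>, without changing it modulo 4.\<close>
  have "(shift E ^^ 4) (a, b, c, d) (a, b, c, d)"
    using e by (intro shift_four) (simp_all add: insert_commute)
  moreover have "shift E (a, b, c, d) (b, c, d, a)"
    using e unfolding shift_def by (auto simp: insert_commute)
  ultimately have walk: "(shift E ^^ (4 + 1 + 4 * k)) (a, b, c, d) (a, b, c, d)"
    using k unfolding relpowp_add relpowp_1 by (meson relcomppI)
  have "0 < 4 + 1 + 4 * k" by simp
  from closed_walk_hom[OF assms(1) walk this]
  obtain f where "tight_cycle_hom (4 + 1 + 4 * k) V E f" by blast
  moreover have "4 < 4 + 1 + 4 * k" "(4 + 1 + 4 * k) mod 4 = 1" by presburger+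
  ultimately show False using assms(2) unfolding C1_hom_free_def by blast
qed

subsection \<open>Counting triples\<close>

lemma card_triples:
  assumes "finite X" "P \<subseteq> X \<times> X \<times> X"
  shows "card P = (\<Sum>d\<in>X. card {(b, c). (b, c, d) \<in> P})"
    and "card P = (\<Sum>(b, c)\<in>X \<times> X. card {d. (b, c, d) \<in> P})"
    and "card P = (\<Sum>(b, d)\<in>X \<times> X. card {c. (b, c, d) \<in> P})"
    and "card P = (\<Sum>b\<in>X. card {(c, d). (b, c, d) \<in> P})"
proof -
  have fP: "finite P" using assms by (auto intro: finite_subset[OF _ finite_cartesian_product])
  \<comment> \<open>The map \<open>g\<close> reassembles a triple from an outer part
    \<open>u\<close> and an inner part \<open>v\<close>; the four claims are four choices of
    \<open>g\<close>.\<close>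
  have aux: "card P = (\<Sum>u\<in>U. card {v. g u v \<in> P})"
    if U: "finite U" and g: "\<And>u v u' v'. g u v = g u' v' \<longleftrightarrow> u = u' \<and> v = v'"
      and s: "\<And>p. p \<in> P \<Longrightarrow> \<exists>u\<in>U. \<exists>v. p = g u v"
    for U :: "'u set" and g :: "'u \<Rightarrow> 'v \<Rightarrow> 'a \<times> 'a \<times> 'a"
  proof -
    have fin: "finite {v. g u v \<in> P}" for u
    proof (rule finite_imageD)
      show "finite (g u ` {v. g u v \<in> P})" by (rule finite_subset[OF _ fP]) auto
      show "inj_on (g u) {v. g u v \<in> P}" using g by (auto intro: inj_onI)
    qed
    have "P = (\<lambda>(u, v). g u v) ` (SIGMA u:U. {v. g u v \<in> P})"
      using s by fastforce
    moreover have "inj_on (\<lambda>(u, v). g u v) (SIGMA u:U. {v. g u v \<in> P})"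
      using g by (auto intro: inj_onI)
    ultimately have "card P = card (SIGMA u:U. {v. g u v \<in> P})"
      using card_image by metis
    then show ?thesis using U fin by (simp add: card_SigmaI)
  qed
  have "card P = (\<Sum>u\<in>X. card {v. (case (u, v) of (d, b, c) \<Rightarrow> (b, c, d)) \<in> P})"
    by (rule aux) (use assms in \<open>auto split: prod.splits\<close>)
  then show "card P = (\<Sum>d\<in>X. card {(b, c). (b, c, d) \<in> P})" by (simp add: case_prod_unfold)
  have "card P = (\<Sum>u\<in>X \<times> X. card {v. (case (u, v) of ((b, c), d) \<Rightarrow> (b, c, d)) \<in> P})"
    by (rule aux) (use assms in \<open>auto split: prod.splits\<close>)
  then show "card P = (\<Sum>(b, c)\<in>X \<times> X. card {d. (b, c, d) \<in> P})" by (simp add: case_prod_unfold)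
  have "card P = (\<Sum>u\<in>X \<times> X. card {v. (case (u, v) of ((b, d), c) \<Rightarrow> (b, c, d)) \<in> P})"
    by (rule aux) (use assms in \<open>auto split: prod.splits\<close>)
  then show "card P = (\<Sum>(b, d)\<in>X \<times> X. card {c. (b, c, d) \<in> P})" by (simp add: case_prod_unfold)
  have "card P = (\<Sum>u\<in>X. card {v. (case (u, v) of (b, c, d) \<Rightarrow> (b, c, d)) \<in> P})"
    by (rule aux) (use assms in \<open>auto split: prod.splits\<close>)
  then show "card P = (\<Sum>b\<in>X. card {(c, d). (b, c, d) \<in> P})" by (simp add: case_prod_unfold)
qed

text \<open>For fixed \<open>d\<close>, the number of pairs \<open>(b, c)\<close> is at most
  \<open>card R\<close> and at most the square of the in-degree of \<open>d\<close> in
  \<open>S\<close>, hence at most the geometric mean of the two. In-degrees sum to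
  \<open>card S\<close>.\<close>

lemma triple_bound:
  assumes "finite X" "P \<subseteq> X \<times> X \<times> X" "R \<subseteq> X \<times> X" "S \<subseteq> X \<times> X"
    and sub: "\<And>b c d. (b, c, d) \<in> P \<Longrightarrow> (b, c) \<in> R \<and> (b, d) \<in> S \<and> (c, d) \<in> S"
  shows "real (card P) \<le> real (card S) * sqrt (real (card R))"
proof -
  have fR: "finite R" using assms by (auto intro: finite_subset[OF _ finite_cartesian_product])
  have fS: "finite {b. (b, d) \<in> S}" for d
    by (rule finite_subset[OF _ assms(1)]) (use assms(4) in auto)
  have "real (card {(b, c). (b, c, d) \<in> P}) \<le> real (card {b. (b, d) \<in> S}) * sqrt (real (card R))" for d
  proof -
    let ?k = "card {(b, c). (b, c, d) \<in> P}" and ?i = "card {b. (b, d) \<in> S}"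
    have 1: "?k \<le> card R" by (rule card_mono[OF fR]) (use sub in auto)
    have "?k \<le> card ({b. (b, d) \<in> S} \<times> {b. (b, d) \<in> S})"
      by (rule card_mono) (use fS sub in auto)
    then have 2: "?k \<le> ?i * ?i" by (simp add: card_cartesian_product)
    have "?k * ?k \<le> card R * (?i * ?i)" using 1 2 by (rule mult_mono) auto
    then have "real (?k * ?k) \<le> real (card R * (?i * ?i))" by (simp only: of_nat_le_iff)
    then have "sqrt (real ?k ^ 2) \<le> sqrt (real (card R) * real ?i ^ 2)"
      by (intro real_sqrt_le_mono) (simp add: power2_eq_square)
    then show ?thesis by (simp add: real_sqrt_mult mult.commute)
  qed
  then have "real (card P) \<le> (\<Sum>d\<in>X. real (card {b. (b, d) \<in> S}) * sqrt (real (card R)))"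
    unfolding card_triples(1)[OF assms(1,2)] of_nat_sum by (intro sum_mono)
  also have "\<dots> = real (card S) * sqrt (real (card R))"
  proof -
    have "S = (\<lambda>(d, b). (b, d)) ` (SIGMA d:X. {b. (b, d) \<in> S})" using assms(4) by force
    moreover have "inj_on (\<lambda>(d, b). (b, d)) (SIGMA d:X. {b. (b, d) \<in> S})" by (auto intro: inj_onI)
    ultimately have "card S = card (SIGMA d:X. {b. (b, d) \<in> S})" using card_image by metis
    also have "\<dots> = (\<Sum>d\<in>X. card {b. (b, d) \<in> S})" using assms(1) fS by (simp add: card_SigmaI)
    finally show ?thesis by (simp add: sum_distrib_right)
  qed
  finally show ?thesis .
qed

lemma sum_card_restrict:
  fixes k :: "'a \<times> 'a \<Rightarrow> nat"
  assumes "finite X" "R \<subseteq> X \<times> X" "\<And>p. p \<notin> R \<Longrightarrow> k p = 0"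
  shows "(\<Sum>p\<in>X \<times> X. k p) = (\<Sum>p\<in>R. k p)"
  by (rule sum.mono_neutral_right) (use assms in auto)

text \<open>This is Cauchy-Schwarz in linear form: the square lies above its tangent at
  \<open>a * N\<close>. The free \<open>a\<close> is set to the expected extremal codegree divided
  by \<open>N\<close>.\<close>

lemma sum_square_tangent:
  fixes f :: "'b \<Rightarrow> nat" and a N :: real
  shows "2 * a * N * real (sum f Q) - a\<^sup>2 * N\<^sup>2 * real (card Q) \<le> (\<Sum>p\<in>Q. real (f p) ^ 2)"
proof -
  have "2 * a * N * x - a\<^sup>2 * N\<^sup>2 \<le> x\<^sup>2" for x :: real
    using zero_le_power2[of "x - a * N"] by (simp add: power2_eq_square algebra_simps)
  then have "(\<Sum>p\<in>Q. 2 * a * N * real (f p) - a\<^sup>2 * N\<^sup>2) \<le> (\<Sum>p\<in>Q. real (f p) ^ 2)"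
    by (intro sum_mono)
  then show ?thesis
    by (simp add: sum_subtractf sum_distrib_left sum_distrib_right mult.commute mult.left_commute)
qed

lemma sum_codegree:
  assumes "finite X" "P \<subseteq> X \<times> X \<times> X" "R \<subseteq> X \<times> X"
    and sub: "\<And>b c d. (b, c, d) \<in> P \<Longrightarrow> (b, c) \<in> R"
  shows "(\<Sum>(b, c, d)\<in>P. real (card {e. (b, c, e) \<in> P}))
    = (\<Sum>p\<in>R. real (card {e. (fst p, snd p, e) \<in> P}) ^ 2)"
proof -
  define u where "u p = card {d. (fst p, snd p, d) \<in> P}" for p
  have fR: "finite R"
    using assms by (auto intro: finite_subset[OF _ finite_cartesian_product])
  have fin: "finite {d. (x, y, d) \<in> P}" for x y
    by (rule finite_subset[OF _ assms(1)]; use assms(2) in auto)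
  have "(\<Sum>p\<in>R. real (u p) ^ 2) = (\<Sum>p\<in>R. \<Sum>d\<in>{d. (fst p, snd p, d) \<in> P}. real (u p))"
    unfolding power2_eq_square by (simp add: u_def)
  also have "\<dots> = (\<Sum>(p, d)\<in>(SIGMA p:R. {d. (fst p, snd p, d) \<in> P}). real (u p))"
    by (rule sum.Sigma) (use fR fin in simp_all)
  also have "\<dots> = (\<Sum>(b, c, d)\<in>P. real (u (b, c)))"
    by (rule sum.reindex_bij_witness[where j="\<lambda>(p, d). (fst p, snd p, d)" and i="\<lambda>(b, c, d). ((b, c), d)"])
      (use sub in auto)
  finally show ?thesis by (simp add: u_def)
qed

text \<open>For \<open>(b, c, d)\<close> in \<open>P\<close>, no \<open>e\<close> can replace both
  \<open>d\<close> and \<open>c\<close>, since \<open>(b, e)\<close> would lie in both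
  \<open>S\<close> and \<open>R\<close>. Hence the codegrees of \<open>(b, c)\<close> and
  \<open>(b, d)\<close> add up to at most \<open>card X\<close>; summing over \<open>P\<close>
  bounds the sums of squared codegrees.\<close>

lemma codegree_bound:
  fixes r :: real
  assumes fX: "finite X" and P: "P \<subseteq> X \<times> X \<times> X" and R: "R \<subseteq> X \<times> X" and S: "S \<subseteq> X \<times> X"
    and sub: "\<And>b c d. (b, c, d) \<in> P \<Longrightarrow> (b, c) \<in> R \<and> (b, d) \<in> S"
    and disj: "R \<inter> S = {}"
  shows "real (card P) \<le> real (card X) * (r\<^sup>2 * real (card R) + (1 - r)\<^sup>2 * real (card S))"
proof -
  define N where "N = real (card X)"
  define u where "u p = card {d. (fst p, snd p, d) \<in> P}" for p
  define v where "v p = card {c. (fst p, c, snd p) \<in> P}" for p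
  have fR: "finite R" and fS: "finite S"
    using fX R S by (auto intro: finite_subset[OF _ finite_cartesian_product])
  have fin: "finite {d. (x, y, d) \<in> P}" "finite {c. (x, c, y) \<in> P}" for x y
    by (rule finite_subset[OF _ fX]; use P in auto)+
  have u0: "u p = 0" if "p \<notin> R" for p using that sub unfolding u_def by (cases p) (auto simp: card_eq_0_iff)
  have v0: "v p = 0" if "p \<notin> S" for p using that sub unfolding v_def by (cases p) (auto simp: card_eq_0_iff)
  have su: "card P = (\<Sum>p\<in>R. u p)"
    using card_triples(2)[OF fX P] sum_card_restrict[OF fX R u0]
    unfolding u_def by (simp add: case_prod_unfold)
  have sv: "card P = (\<Sum>p\<in>S. v p)"
    using card_triples(3)[OF fX P] sum_card_restrict[OF fX S v0]
    unfolding v_def by (simp add: case_prod_unfold)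
  have le: "u (b, c) + v (b, d) \<le> card X" if "(b, c, d) \<in> P" for b c d
  proof -
    have "u (b, c) + v (b, d) = card ({e. (b, c, e) \<in> P} \<union> {e. (b, e, d) \<in> P})"
      unfolding u_def v_def fst_conv snd_conv
    proof (rule card_Un_disjoint[OF fin(1) fin(2), symmetric])
      show "{e. (b, c, e) \<in> P} \<inter> {e. (b, e, d) \<in> P} = {}"
        using sub disj by blast
    qed
    also have "\<dots> \<le> card X" by (rule card_mono[OF fX]) (use P in auto)
    finally show ?thesis .
  qed
  have squ: "(\<Sum>(b, c, d)\<in>P. real (u (b, c))) = (\<Sum>p\<in>R. real (u p) ^ 2)"
    unfolding u_def using sum_codegree[OF fX P R] sub by simp
  have sqv: "(\<Sum>(b, c, d)\<in>P. real (v (b, d))) = (\<Sum>p\<in>S. real (v p) ^ 2)"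
  proof -
    have "(\<Sum>p\<in>S. real (v p) ^ 2) = (\<Sum>p\<in>S. \<Sum>c\<in>{c. (fst p, c, snd p) \<in> P}. real (v p))"
      unfolding power2_eq_square by (simp add: v_def)
    also have "\<dots> = (\<Sum>(p, c)\<in>(SIGMA p:S. {c. (fst p, c, snd p) \<in> P}). real (v p))"
      by (rule sum.Sigma) (use fS fin in simp_all)
    also have "\<dots> = (\<Sum>(b, c, d)\<in>P. real (v (b, d)))"
      by (rule sum.reindex_bij_witness[where j="\<lambda>(p, c). (fst p, c, snd p)" and i="\<lambda>(b, c, d). ((b, d), c)"])
        (use sub in auto)
    finally show ?thesis by simp
  qed
  have "(\<Sum>p\<in>R. real (u p) ^ 2) + (\<Sum>p\<in>S. real (v p) ^ 2) = (\<Sum>(b, c, d)\<in>P. real (u (b, c)) + real (v (b, d)))"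
    unfolding squ[symmetric] sqv[symmetric] by (simp add: sum.distrib[symmetric] case_prod_unfold)
  also have "\<dots> \<le> (\<Sum>(b, c, d)\<in>P. N)"
    unfolding N_def by (rule sum_mono) (use le in \<open>auto simp flip: of_nat_add\<close>)
  also have "\<dots> = N * real (card P)" by (simp add: case_prod_unfold)
  finally have main: "(\<Sum>p\<in>R. real (u p) ^ 2) + (\<Sum>p\<in>S. real (v p) ^ 2) \<le> N * real (card P)" .
  \<comment> \<open>The tangents at \<open>r * N\<close> and \<open>(1 - r) * N\<close> contribute
    \<open>2 * N * card P\<close> together, which leaves \<open>N * card P\<close> after comparison
    with the upper bound.\<close>
  from sum_square_tangent[of r N u R] sum_square_tangent[of "1 - r" N v S] main
  have "2 * r * N * real (card P) - r\<^sup>2 * N\<^sup>2 * real (card R)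
      + (2 * (1 - r) * N * real (card P) - (1 - r)\<^sup>2 * N\<^sup>2 * real (card S)) \<le> N * real (card P)"
    unfolding of_nat_sum[symmetric] su[symmetric] sv[symmetric] by linarith
  then have *: "N * real (card P) \<le> N * (N * (r\<^sup>2 * real (card R) + (1 - r)\<^sup>2 * real (card S)))"
    by (simp add: power2_eq_square algebra_simps)
  show ?thesis
  proof (cases "X = {}")
    case True
    then show ?thesis using P by auto
  next
    case False
    then have "N > 0" unfolding N_def using fX by (simp add: card_gt_0_iff)
    with * show ?thesis unfolding N_def[symmetric] by simp
  qed
qed

text \<open>By \<open>disj\<close> and rotation, the three sides of a triple have disjoint sets of
  third vertices, so their codegrees add up to at most \<open>card X\<close>. The tangent is taken
  at the average codegree, one third of \<open>card X\<close>.\<close>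

lemma rotation_bound:
  assumes fX: "finite X" and P: "P \<subseteq> X \<times> X \<times> X" and R: "R \<subseteq> X \<times> X"
    and sub: "\<And>b c d. (b, c, d) \<in> P \<Longrightarrow> (b, c) \<in> R"
    and rot: "\<And>b c d. (b, c, d) \<in> P \<Longrightarrow> (c, d, b) \<in> P"
    and disj: "\<And>b c d e. (b, c, d) \<in> P \<Longrightarrow> (b, c, e) \<in> P \<Longrightarrow> (c, d, e) \<in> P \<Longrightarrow> False"
  shows "3 * real (card P) \<le> real (card X) * real (card R)"
proof -
  define N where "N = real (card X)"
  define u where "u p = card {d. (fst p, snd p, d) \<in> P}" for p
  have fin: "finite {d. (x, y, d) \<in> P}" for x y
    by (rule finite_subset[OF _ fX]; use P in auto)
  have u0: "u p = 0" if "p \<notin> R" for p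
    using that sub unfolding u_def by (cases p) (auto simp: card_eq_0_iff)
  have su: "card P = (\<Sum>p\<in>R. u p)"
    using card_triples(2)[OF fX P] sum_card_restrict[OF fX R u0]
    unfolding u_def by (simp add: case_prod_unfold)
  have squ: "(\<Sum>(b, c, d)\<in>P. real (u (b, c))) = (\<Sum>p\<in>R. real (u p) ^ 2)"
    unfolding u_def using sum_codegree[OF fX P R] sub by simp
  have le: "u (b, c) + u (c, d) + u (d, b) \<le> card X" if t: "(b, c, d) \<in> P" for b c d
  proof -
    have t': "(c, d, b) \<in> P" "(d, b, c) \<in> P" using rot t by blast+
    have 1: "{e. (b, c, e) \<in> P} \<inter> {e. (c, d, e) \<in> P} = {}" using disj t by blast
    have 2: "{e. (c, d, e) \<in> P} \<inter> {e. (d, b, e) \<in> P} = {}" using disj t' by blast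
    have 3: "{e. (b, c, e) \<in> P} \<inter> {e. (d, b, e) \<in> P} = {}" using disj t' t by blast
    have "u (b, c) + u (c, d) + u (d, b)
        = card ({e. (b, c, e) \<in> P} \<union> {e. (c, d, e) \<in> P} \<union> {e. (d, b, e) \<in> P})"
      unfolding u_def fst_conv snd_conv using fin 1 2 3
      by (subst card_Un_disjoint, simp, simp, blast, subst card_Un_disjoint, auto)
    also have "\<dots> \<le> card X" by (rule card_mono[OF fX]) (use P in auto)
    finally show ?thesis .
  qed
  have rot1: "(\<Sum>(b, c, d)\<in>P. real (u (c, d))) = (\<Sum>(b, c, d)\<in>P. real (u (b, c)))"
    by (rule sum.reindex_bij_witness[where j="\<lambda>(b, c, d). (c, d, b)" and i="\<lambda>(b, c, d). (d, b, c)"])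
      (use rot in auto)
  have rot2: "(\<Sum>(b, c, d)\<in>P. real (u (d, b))) = (\<Sum>(b, c, d)\<in>P. real (u (b, c)))"
    by (rule sum.reindex_bij_witness[where j="\<lambda>(b, c, d). (d, b, c)" and i="\<lambda>(b, c, d). (c, d, b)"])
      (use rot in auto)
  have "3 * (\<Sum>p\<in>R. real (u p) ^ 2)
      = (\<Sum>(b, c, d)\<in>P. real (u (b, c)) + real (u (c, d)) + real (u (d, b)))"
    using rot1 rot2 unfolding squ[symmetric] by (simp add: sum.distrib case_prod_unfold)
  also have "\<dots> \<le> (\<Sum>(b, c, d)\<in>P. N)"
    unfolding N_def by (rule sum_mono) (use le in \<open>auto simp flip: of_nat_add\<close>)
  also have "\<dots> = N * real (card P)" by (simp add: case_prod_unfold)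
  finally have "3 * (\<Sum>p\<in>R. real (u p) ^ 2) \<le> N * real (card P)" .
  with sum_square_tangent[of "1/3" N u R]
  have "3 * (2 / 3 * N * real (card P) - N\<^sup>2 / 9 * real (card R)) \<le> N * real (card P)"
    unfolding su[symmetric] by (simp add: power2_eq_square)
  then have *: "N * (3 * real (card P)) \<le> N * (N * real (card R))"
    by (simp add: power2_eq_square algebra_simps)
  show ?thesis
  proof (cases "X = {}")
    case True
    then show ?thesis using P by auto
  next
    case False
    then have "N > 0" unfolding N_def using fX by (simp add: card_gt_0_iff)
    with * show ?thesis unfolding N_def[symmetric] by simp
  qed
qed

subsection \<open>Cherries in mixed graphs\<close>

definition cherries :: "('a \<Rightarrow> 'a \<Rightarrow> bool) \<Rightarrow> ('a \<Rightarrow> 'a \<Rightarrow> bool) \<Rightarrow> 'a set \<Rightarrow> ('a \<times> 'a \<times> 'a) set" where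
  "cherries h D X = {(b, c, d) \<in> X \<times> X \<times> X. h b c \<and> D b d \<and> D c d}"

text \<open>A cherry through \<open>v\<close> has it as sink or as one end of the base. The latter
  counts twice because both orders of the base are counted.\<close>

lemma cherries_remove:
  assumes "finite X" "v \<in> X" and h: "\<And>x y. h x y \<Longrightarrow> h y x \<and> \<not> D x y" and irr: "\<And>x. \<not> h x x" "\<And>x. \<not> D x x"
  shows "card (cherries h D X) \<le> card (cherries h D (X - {v}))
    + 2 * card {(c, d). (v, c, d) \<in> cherries h D X} + card {(b, c). (b, c, v) \<in> cherries h D X}"
proof -
  let ?C = "cherries h D X"
  let ?A = "(\<lambda>(c, d). (v, c, d)) ` {(c, d). (v, c, d) \<in> ?C}"
  let ?B = "(\<lambda>(c, d). (c, v, d)) ` {(c, d). (v, c, d) \<in> ?C}"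
  let ?S = "(\<lambda>(b, c). (b, c, v)) ` {(b, c). (b, c, v) \<in> ?C}"
  have "?C \<subseteq> X \<times> X \<times> X" unfolding cherries_def by auto
  then have fin: "finite {(c, d). (v, c, d) \<in> ?C}" "finite {(b, c). (b, c, v) \<in> ?C}"
    by (auto intro!: finite_subset[OF _ finite_cartesian_product[OF assms(1,1)]])
  have sub: "?C \<subseteq> cherries h D (X - {v}) \<union> ?A \<union> ?B \<union> ?S"
    unfolding cherries_def using h by (force simp: image_iff)
  have "finite (cherries h D (X - {v}))"
    by (rule finite_subset[of _ "X \<times> X \<times> X"]) (use assms in \<open>auto simp: cherries_def\<close>)
  then have "card ?C \<le> card (cherries h D (X - {v}) \<union> ?A \<union> ?B \<union> ?S)"
    using fin by (intro card_mono[OF _ sub]) auto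
  also have "\<dots> \<le> card (cherries h D (X - {v})) + card ?A + card ?B + card ?S"
    by (meson add_mono card_Un_le le_trans order_refl)
  also have "\<dots> \<le> card (cherries h D (X - {v})) + card {(c, d). (v, c, d) \<in> ?C}
      + card {(c, d). (v, c, d) \<in> ?C} + card {(b, c). (b, c, v) \<in> ?C}"
    using fin by (intro add_mono card_image_le order_refl)
  finally show ?thesis by simp
qed

locale mixed_graph =
  fixes h D :: "'a \<Rightarrow> 'a \<Rightarrow> bool"
  assumes h_sym: "h x y \<Longrightarrow> h y x"
    and h_irrefl: "\<not> h x x"
    and D_asym: "D x y \<Longrightarrow> \<not> D y x"
    and h_D: "h x y \<Longrightarrow> \<not> D x y"
begin

definition hdeg :: "'a set \<Rightarrow> 'a \<Rightarrow> nat" where "hdeg X v = card {c \<in> X. h v c}"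
definition outdeg :: "'a set \<Rightarrow> 'a \<Rightarrow> nat" where "outdeg X v = card {c \<in> X. D v c}"
definition indeg :: "'a set \<Rightarrow> 'a \<Rightarrow> nat" where "indeg X v = card {c \<in> X. D c v}"
definition base_count :: "'a set \<Rightarrow> 'a \<Rightarrow> nat" where
  "base_count X v = card {(c, d). (v, c, d) \<in> cherries h D X}"
definition sink_count :: "'a set \<Rightarrow> 'a \<Rightarrow> nat" where
  "sink_count X v = card {(b, c). (b, c, v) \<in> cherries h D X}"

lemma degree_sum:
  assumes "finite X" "v \<in> X"
  shows "hdeg X v + outdeg X v + indeg X v \<le> card X - 1"
proof -
  have "hdeg X v + outdeg X v + indeg X v = card ({c \<in> X. h v c} \<union> {c \<in> X. D v c} \<union> {c \<in> X. D c v})"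
    unfolding hdeg_def outdeg_def indeg_def using assms(1) D_asym h_D h_sym
    by (subst card_Un_disjoint, simp, simp, blast, subst card_Un_disjoint, auto)
  also have "\<dots> \<le> card (X - {v})"
    using assms h_irrefl D_asym by (intro card_mono) auto
  finally show ?thesis using assms by simp
qed

lemma base_count_le:
  assumes "finite X"
  shows "base_count X v \<le> hdeg X v * outdeg X v"
  unfolding base_count_def hdeg_def outdeg_def card_cartesian_product[symmetric]
  by (rule card_mono) (use assms in \<open>auto simp: cherries_def\<close>)

lemma sink_count_le:
  assumes "finite X"
  shows "sink_count X v \<le> indeg X v * indeg X v"
  unfolding sink_count_def indeg_def card_cartesian_product[symmetric]
  by (rule card_mono) (use assms in \<open>auto simp: cherries_def\<close>)

lemma sum_base_count:
  assumes "finite X"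
  shows "(\<Sum>v\<in>X. base_count X v) = card (cherries h D X)"
  unfolding base_count_def
  by (rule card_triples(4)[OF assms, symmetric]) (auto simp: cherries_def)

lemma sum_sink_count:
  assumes "finite X"
  shows "(\<Sum>v\<in>X. sink_count X v) = card (cherries h D X)"
  unfolding sink_count_def
  by (rule card_triples(1)[OF assms, symmetric]) (auto simp: cherries_def)

text \<open>Base counts and sink counts have the same sum, so some \<open>v\<close> has
  \<open>sink_count\<close> at most \<open>base_count\<close>. With in-degree \<open>i\<close>, the
  estimate \<open>(M - i)^2 / 2 + i^2\<close> suffices up to \<open>i = 2 * M / 3\<close>, where it
  returns to \<open>M^2 / 2\<close>; beyond that, three times the base count suffices.\<close>

lemma exists_half:
  assumes "finite X" "X \<noteq> {}"
  shows "\<exists>v\<in>X. 2 * real (base_count X v) + real (sink_count X v) \<le> real (card X - 1) ^ 2 / 2"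
proof -
  have "\<exists>v\<in>X. sink_count X v \<le> base_count X v"
  proof (rule ccontr)
    assume "\<not> ?thesis"
    then have "(\<Sum>v\<in>X. base_count X v) < (\<Sum>v\<in>X. sink_count X v)"
      using assms by (intro sum_strict_mono) auto
    then show False using sum_base_count[OF assms(1)] sum_sink_count[OF assms(1)] by simp
  qed
  then obtain v where v: "v \<in> X" "sink_count X v \<le> base_count X v" by blast
  define M where "M = real (card X - 1)"
  define a b i where "a = real (hdeg X v)" and "b = real (outdeg X v)" and "i = real (indeg X v)"
  have s: "a + b + i \<le> M" using degree_sum[OF assms(1) v(1)] unfolding M_def a_def b_def i_def by linarith
  have x: "real (base_count X v) \<le> a * b"
    using base_count_le[OF assms(1)] unfolding a_def b_def by (simp flip: of_nat_mult)
  have y: "real (sink_count X v) \<le> i * i"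
    using sink_count_le[OF assms(1)] unfolding i_def by (simp flip: of_nat_mult)
  have nn: "0 \<le> a" "0 \<le> b" "0 \<le> i" unfolding a_def b_def i_def by simp_all
  have "(a + b)\<^sup>2 \<le> (M - i)\<^sup>2" using s nn by (intro power_mono) auto
  moreover have "0 \<le> (a - b)\<^sup>2" by simp
  ultimately have ab: "4 * (a * b) \<le> (M - i)\<^sup>2" by (simp add: power2_eq_square algebra_simps)
  have "2 * real (base_count X v) + real (sink_count X v) \<le> M\<^sup>2 / 2"
  proof (cases "3 * i \<le> 2 * M")
    case True
    then have "0 \<le> i * (2 * M - 3 * i)" using nn by simp
    then have "(M - i)\<^sup>2 / 2 + i * i \<le> M\<^sup>2 / 2" by (simp add: power2_eq_square field_simps)
    then show ?thesis using x y ab by linarith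
  next
    case False
    then have "(M - i)\<^sup>2 \<le> (M / 3)\<^sup>2" using s nn by (intro power_mono) auto
    moreover have "(M / 3)\<^sup>2 = M\<^sup>2 / 9" "0 \<le> M\<^sup>2" by (simp_all add: power_divide)
    ultimately have "3 / 4 * (M - i)\<^sup>2 \<le> M\<^sup>2 / 2" by linarith
    then show ?thesis using x ab v(2) by linarith
  qed
  then show ?thesis using v(1) unfolding M_def by blast
qed

text \<open>If every vertex exceeds this bound, then each vertex has in-degree either below \<open>0.013 M\<close> (the set
  \<open>U\<close>) or above \<open>0.65 M\<close> (the set \<open>W\<close>). Vertices of \<open>U\<close> have large out-degree, and their arcs end
  almost only in \<open>W\<close>, so \<open>W\<close> is large; but vertices of \<open>W\<close> lie in few bases.\<close>

lemma exists_strong: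
  assumes fX: "finite X" and big: "40 \<le> card X"
  shows "\<exists>v\<in>X. 2 * real (base_count X v) + real (sink_count X v) \<le> 39 / 80 * real (card X - 1) ^ 2"
proof (rule ccontr)
  define M where "M = real (card X - 1)"
  define a b i where "a v = real (hdeg X v)" and "b v = real (outdeg X v)" and "i v = real (indeg X v)" for v
  assume "\<not> ?thesis"
  then have large: "39 / 80 * M\<^sup>2 < 2 * real (base_count X v) + real (sink_count X v)" if "v \<in> X" for v
    using that unfolding M_def by (auto simp: not_le)
  have M: "39 \<le> M" "real (card X) = M + 1" using big unfolding M_def by auto
  have nn: "0 \<le> a v" "0 \<le> b v" "0 \<le> i v" for v unfolding a_def b_def i_def by simp_all
  have s: "a v + b v + i v \<le> M" if "v \<in> X" for v
    using degree_sum[OF fX that] unfolding M_def a_def b_def i_def by linarith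
  have x: "real (base_count X v) \<le> a v * b v" for v
    using base_count_le[OF fX] unfolding a_def b_def by (simp flip: of_nat_mult)
  have y: "real (sink_count X v) \<le> i v * i v" for v
    using sink_count_le[OF fX] unfolding i_def by (simp flip: of_nat_mult)
  have amgm: "4 * (a v * b v) \<le> (M - i v)\<^sup>2" if "v \<in> X" for v
  proof -
    have "(a v + b v)\<^sup>2 \<le> (M - i v)\<^sup>2" using s[OF that] nn[of v] by (intro power_mono) auto
    moreover have "0 \<le> (a v - b v)\<^sup>2" by simp
    ultimately show ?thesis by (simp add: power2_eq_square algebra_simps)
  qed
  define U where "U = {v \<in> X. i v < 13 / 1000 * M}"
  define W where "W = X - U"
  have fUW: "finite U" "finite W" "U \<inter> W = {}" "X = U \<union> W" unfolding U_def W_def using fX by auto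
  define k w where "k = real (card U)" and "w = real (card W)"
  have kw: "k + w = M + 1" unfolding k_def w_def M(2)[symmetric] fUW(4)
    using fUW by (simp add: card_Un_disjoint)
  have k0: "0 \<le> k" "0 \<le> w" unfolding k_def w_def by simp_all
  have W: "a v * b v \<le> 31 / 1000 * M\<^sup>2" if "v \<in> W" for v
  proof -
    have v: "v \<in> X" "13 / 1000 * M \<le> i v" using that unfolding W_def U_def by auto
    \<comment> \<open>With \<open>t = i v / M\<close>, the assumed lower bound forces
      \<open>3/2 * t^2 - t + 1/80 > 0\<close>. The numbers 0.013 and 0.65 lie just inside the two
      roots.\<close>
    have "65 / 100 * M < i v"
    proof (rule ccontr)
      assume "\<not> ?thesis"
      then have "0 \<le> (i v - 13 / 1000 * M) * (65 / 100 * M - i v)"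
        using v by (intro mult_nonneg_nonneg) auto
      then have "20000 * (i v * i v) \<le> 13260 * (M * i v) - 169 * (M * M)"
        by (simp add: field_simps)
      moreover have "0 \<le> M * i v" "0 \<le> M * M" using nn[of v] M by simp_all
      moreover have "39 / 80 * M\<^sup>2 < (M - i v)\<^sup>2 / 2 + i v * i v"
        using large[OF v(1)] x[of v] y[of v] amgm[OF v(1)] by linarith
      then have "80 * (M * i v) < M * M + 120 * (i v * i v)"
        by (simp add: power2_eq_square field_simps)
      ultimately show False by linarith
    qed
    then have "(M - i v)\<^sup>2 \<le> (35 / 100 * M)\<^sup>2" using s[OF v(1)] nn[of v] by (intro power_mono) auto
    also have "\<dots> = 1225 / 10000 * M\<^sup>2" by (simp add: power2_eq_square)
    finally show ?thesis using amgm[OF v(1)] zero_le_power2[of M] by linarith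
  qed
  have U: "42 / 100 * M \<le> b v" "a v * b v \<le> 1 / 5 * M * b v + 16 / 100 * M\<^sup>2" if "v \<in> U" for v
  proof -
    have v: "v \<in> X" "i v < 13 / 1000 * M" using that unfolding U_def by auto
    have "a v * b v \<le> (M - b v) * b v" using s[OF v(1)] nn[of v] by (intro mult_right_mono) auto
    then have ab: "a v * b v \<le> M * b v - (b v)\<^sup>2" by (simp add: power2_eq_square algebra_simps)
    \<comment> \<open>This is the tangent of \<open>(M - b) * b\<close> at
      \<open>b = 4/10 * M\<close>. Being linear in \<open>b\<close>, it can be summed over
      \<open>U\<close> in terms of the number of arcs.\<close>
    have "0 \<le> (b v - 4 / 10 * M)\<^sup>2" by simp
    then have "M * b v - (b v)\<^sup>2 \<le> 1 / 5 * M * b v + 16 / 100 * M\<^sup>2"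
      by (simp add: power2_eq_square algebra_simps)
    with ab show "a v * b v \<le> 1 / 5 * M * b v + 16 / 100 * M\<^sup>2" by linarith
    show "42 / 100 * M \<le> b v"
    proof (rule ccontr)
      assume "\<not> ?thesis"
      then have "0 \<le> (42 / 100 * M - b v) * (58 / 100 * M - b v)"
        using M by (intro mult_nonneg_nonneg) auto
      then have "M * b v - (b v)\<^sup>2 \<le> 2436 / 10000 * M\<^sup>2"
        by (simp add: power2_eq_square algebra_simps)
      moreover have "i v * i v \<le> 13 / 1000 * M * (13 / 1000 * M)"
        using v nn[of v] by (intro mult_mono) auto
      then have "i v * i v \<le> 169 / 1000000 * M\<^sup>2" by (simp add: power2_eq_square)
      moreover have "0 < M\<^sup>2" using M by simp
      ultimately show False using large[OF v(1)] x[of v] y[of v] ab by linarith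
    qed
  qed
  \<comment> \<open>Arcs leaving \<open>U\<close> are counted by their heads: a head in
    \<open>U\<close> has small in-degree, and a head in \<open>W\<close> receives at most
    \<open>k\<close> of them.\<close>
  have arcs: "(\<Sum>v\<in>U. b v) \<le> k * (13 / 1000 * M + w)"
  proof -
    have "(\<Sum>v\<in>U. b v) = (\<Sum>v\<in>U. \<Sum>d\<in>X. if D v d then 1 else 0)"
      unfolding b_def outdeg_def using fX by (simp add: sum.If_cases Int_def)
    also have "\<dots> = (\<Sum>d\<in>X. \<Sum>v\<in>U. if D v d then 1 else 0)" by (rule sum.swap)
    also have "\<dots> = (\<Sum>d\<in>U. \<Sum>v\<in>U. if D v d then 1 else 0) + (\<Sum>d\<in>W. \<Sum>v\<in>U. if D v d then 1 else 0)"
      unfolding fUW(4) by (rule sum.union_disjoint[OF fUW(1,2,3)])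
    also have "(\<Sum>d\<in>U. \<Sum>v\<in>U. if D v d then 1 else 0) \<le> (\<Sum>d\<in>U. 13 / 1000 * M :: real)"
    proof (rule sum_mono)
      fix d assume d: "d \<in> U"
      have "(\<Sum>v\<in>U. if D v d then 1 else 0 :: real) = real (card {v \<in> U. D v d})"
        using fUW(1) by (simp add: sum.If_cases Int_def)
      also have "\<dots> \<le> i d" unfolding i_def indeg_def
        by (simp, rule card_mono) (use fX fUW in auto)
      finally show "(\<Sum>v\<in>U. if D v d then 1 else 0 :: real) \<le> 13 / 1000 * M"
        using d unfolding U_def by auto
    qed
    also have "(\<Sum>d\<in>W. \<Sum>v\<in>U. if D v d then 1 else 0) \<le> (\<Sum>d\<in>W. \<Sum>v\<in>U. 1 :: real)"
      by (intro sum_mono) auto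
    finally show ?thesis unfolding k_def w_def by (simp add: algebra_simps)
  qed
  have w: "407 / 1000 * M \<le> w"
  proof (cases "k = 0")
    case True
    then show ?thesis using kw M by linarith
  next
    case False
    have "k * (42 / 100 * M) = (\<Sum>v\<in>U. 42 / 100 * M)" unfolding k_def by simp
    also have "\<dots> \<le> (\<Sum>v\<in>U. b v)" using U(1) by (intro sum_mono)
    finally have "k * (42 / 100 * M) \<le> k * (13 / 1000 * M + w)" using arcs by linarith
    then show ?thesis using False k0 by simp
  qed
  have Y: "real (card (cherries h D X)) \<le> 1 / 5 * M * (k * (13 / 1000 * M + w)) + 16 / 100 * M\<^sup>2 * k + 31 / 1000 * M\<^sup>2 * w"
  proof -
    have "real (card (cherries h D X)) = (\<Sum>v\<in>X. real (base_count X v))"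
      unfolding sum_base_count[OF fX, symmetric] by simp
    also have "\<dots> \<le> (\<Sum>v\<in>X. a v * b v)" using x by (intro sum_mono)
    also have "\<dots> = (\<Sum>v\<in>U. a v * b v) + (\<Sum>v\<in>W. a v * b v)"
      unfolding fUW(4) by (rule sum.union_disjoint[OF fUW(1,2,3)])
    also have "\<dots> \<le> (\<Sum>v\<in>U. 1 / 5 * M * b v + 16 / 100 * M\<^sup>2) + (\<Sum>v\<in>W. 31 / 1000 * M\<^sup>2)"
      using U(2) W by (intro add_mono sum_mono)
    also have "\<dots> = 1 / 5 * M * (\<Sum>v\<in>U. b v) + 16 / 100 * M\<^sup>2 * k + 31 / 1000 * M\<^sup>2 * w"
      unfolding k_def w_def by (simp add: sum.distrib sum_distrib_left mult.commute)
    also have "1 / 5 * M * (\<Sum>v\<in>U. b v) \<le> 1 / 5 * M * (k * (13 / 1000 * M + w))"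
      using arcs M by (intro mult_left_mono) auto
    finally show ?thesis by simp
  qed
  have "3 * real (card (cherries h D X)) = (\<Sum>v\<in>X. 2 * real (base_count X v) + real (sink_count X v))"
    using sum_base_count[OF fX] sum_sink_count[OF fX]
    by (simp add: sum.distrib flip: sum_distrib_left of_nat_sum)
  also have "(\<Sum>v\<in>X. 39 / 80 * M\<^sup>2) < \<dots>"
    using large fX big by (intro sum_strict_mono) auto
  finally have "13 / 80 * M\<^sup>2 * (M + 1) < real (card (cherries h D X))"
    unfolding M(2)[symmetric] by (simp add: mult_ac)
  with Y have "M * (13 / 80 * M * (M + 1)) < M * (1 / 5 * (k * (13 / 1000 * M + w)) + 16 / 100 * M * k + 31 / 1000 * M * w)"
    by (simp add: power2_eq_square algebra_simps)
  then have main: "13 / 80 * M * (M + 1) < 1 / 5 * (k * (13 / 1000 * M + w)) + 16 / 100 * M * k + 31 / 1000 * M * w"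
    using M by simp
  \<comment> \<open>The excess \<open>e\<close> turns \<open>main\<close> into a quadratic
    inequality in \<open>M\<close> and \<open>e\<close>. Its quadratic part already fails with some
    slack, and \<open>39 \<le> M\<close> lets this slack absorb the linear terms.\<close>
  define e where "e = w - 407 / 1000 * M"
  have we: "w = 407 / 1000 * M + e" "0 \<le> e" "k = M + 1 - 407 / 1000 * M - e"
    using w kw unfolding e_def by auto
  have "39 * M \<le> M * M" "39 * e \<le> M * e" "0 \<le> e * e"
    using M(1) we(2) by (auto intro: mult_right_mono)
  moreover have "13 / 80 * (M * M) + 13 / 80 * M + 1 / 5 * (e * e) + 213 / 1000 * (M * e)
      < 1 / 5 * e + 61 / 250 * M + 157309 / 1000000 * (M * M) + 593 / 5000 * (M * e)"
    using main unfolding we(1,3) by (simp add: field_simps)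
  ultimately show False using M(1) we(2) by linarith
qed

text \<open>The constant is not optimal; it only has to be small enough for the first case of \<open>density_bound\<close>.\<close>

lemma card_cherries_le:
  assumes "finite X"
  shows "real (card (cherries h D X)) \<le> 13 / 80 * real (card X) ^ 3"
  using assms
proof (induction "card X" arbitrary: X)
  case 0
  then show ?case by (simp add: cherries_def case_prod_unfold)
next
  case (Suc m)
  then have ne: "X \<noteq> {}" by auto
  have m: "real (card X - 1) = real m" using Suc(2) by (metis diff_Suc_1)
  \<comment> \<open>The target is the increment \<open>13/80 * ((m + 1)^3 - m^3)\<close>. For
    \<open>m < 39\<close> its linear term compensates for the weaker bound, because
    \<open>1/2 - 39/80 = 1/80\<close>.\<close>
  have "\<exists>v\<in>X. 2 * real (base_count X v) + real (sink_count X v) \<le> 13 / 80 * (3 * real m ^ 2 + 3 * real m + 1)"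
  proof (cases "39 \<le> m")
    case True
    then have "40 \<le> card X" using Suc(2) by simp
    from exists_strong[OF Suc(3) this] obtain v where v: "v \<in> X"
      "2 * real (base_count X v) + real (sink_count X v) \<le> 39 / 80 * real m ^ 2" unfolding m by blast
    then show ?thesis by (intro bexI[of _ v]) auto
  next
    case False
    from exists_half[OF Suc(3) ne] obtain v where v: "v \<in> X"
      "2 * real (base_count X v) + real (sink_count X v) \<le> real m ^ 2 / 2" unfolding m by blast
    have "real m * real m \<le> 38 * real m" using False by (intro mult_right_mono) auto
    then have "real m ^ 2 / 2 \<le> 13 / 80 * (3 * real m ^ 2 + 3 * real m + 1)"
      by (simp add: power2_eq_square)
    with v show ?thesis by (intro bexI[of _ v]) auto
  qed
  then obtain v where v: "v \<in> X"
    "2 * real (base_count X v) + real (sink_count X v) \<le> 13 / 80 * (3 * real m ^ 2 + 3 * real m + 1)"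
    by blast
  have cm: "m = card (X - {v})" using Suc(2,3) v(1) by simp
  have IH: "real (card (cherries h D (X - {v}))) \<le> 13 / 80 * real m ^ 3"
    using Suc(1)[OF cm] Suc(3) unfolding cm[symmetric] by simp
  have "card (cherries h D X) \<le> card (cherries h D (X - {v})) + 2 * base_count X v + sink_count X v"
    unfolding base_count_def sink_count_def
    by (rule cherries_remove[OF Suc(3) v(1)]) (use h_sym h_D h_irrefl D_asym in blast)+
  then have "real (card (cherries h D X)) \<le> real (card (cherries h D (X - {v}))) + (2 * real (base_count X v) + real (sink_count X v))"
    by linarith
  also have "\<dots> \<le> 13 / 80 * real m ^ 3 + 13 / 80 * (3 * real m ^ 2 + 3 * real m + 1)"
    using IH v(2) by linarith
  also have "\<dots> = 13 / 80 * real (card X) ^ 3"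
    unfolding Suc(2)[symmetric] by (simp add: power2_eq_square power3_eq_cube algebra_simps)
  finally show ?case .
qed

end

subsection \<open>The optimisation problem for the link\<close>

lemma cubic_gap:
  fixes w :: real
  assumes "(29 / 125) \<le> w" "w \<le> (43 / 100)"
  shows "5151 / 10000 * (1 - w\<^sup>2) + w ^ 3 \<le> 1 / 2"
proof -
  \<comment> \<open>The third root is chosen to make the linear coefficient almost vanish, so that
    \<open>w^3\<close> is compared with a multiple of \<open>w^2\<close> and a constant.\<close>
  have "0 \<le> (w - (29 / 125)) * ((43 / 100) - w) * (w + (15069 / 100000))"
    using assms by (intro mult_nonneg_nonneg) auto
  also have "\<dots> = (51131 / 100000) * w\<^sup>2 - w ^ 3 - (161 / 50000000) * w - (18791043 / 1250000000)"
    by (simp add: power2_eq_square power3_eq_cube algebra_simps)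
  finally have "w ^ 3 \<le> (51131 / 100000) * w\<^sup>2 - (161 / 50000000) * w - (18791043 / 1250000000)" by simp
  moreover have "(29 / 125)\<^sup>2 \<le> w\<^sup>2" using assms by (intro power_mono) auto
  then have "(841 / 15625) \<le> w\<^sup>2" by (simp add: power2_eq_square)
  ultimately show ?thesis using assms unfolding right_diff_distrib by linarith
qed

text \<open>Equality holds at \<open>\<eta> = \<delta> = \<gamma> = 1/4\<close>, \<open>\<zeta> = 0\<close>, \<open>y = G = 1/8\<close>, the link of a vertex in the
  complete oddly bipartite 4-graph.\<close>

lemma density_bound:
  fixes y G A \<eta> \<delta> \<gamma> \<zeta> :: real
  assumes nonneg: "0 \<le> G" "0 \<le> A" "0 \<le> \<eta>" "0 \<le> \<delta>" "0 \<le> \<gamma>" "0 \<le> \<zeta>"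
    and total: "\<eta> + 2 * \<delta> + \<gamma> + \<zeta> \<le> 1"
    and y1: "y \<le> \<delta> * sqrt \<eta>"
    and y2: "\<And>r. y \<le> r\<^sup>2 * \<eta> + (1 - r)\<^sup>2 * \<delta>"
    and y3: "y \<le> (13 / 80)"
    and Gy: "G \<le> y" and G: "G \<le> \<gamma> * sqrt \<gamma>"
    and GA: "G + A \<le> (\<gamma> + \<zeta>) * sqrt (\<gamma> + \<zeta>)" and A: "A \<le> \<zeta> / 3"
  shows "3 * y + G + A \<le> 1 / 2"
proof -
  define w where "w = sqrt (\<gamma> + \<zeta>)"
  have w0: "0 \<le> w" and ww: "w\<^sup>2 = \<gamma> + \<zeta>" unfolding w_def using nonneg by simp_all
  have GAw: "G + A \<le> w ^ 3"
    using GA w0 unfolding w_def[symmetric] ww[symmetric] by (simp add: power2_eq_square power3_eq_cube)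
  define v where "v = sqrt \<eta>"
  have v0: "0 \<le> v" and vv: "v\<^sup>2 = \<eta>" unfolding v_def using nonneg by simp_all
  have d: "\<delta> \<le> (1 - w\<^sup>2 - v\<^sup>2) / 2" using total unfolding ww vv by simp
  have y1': "y \<le> v * (1 - w\<^sup>2 - v\<^sup>2) / 2"
    using y1 mult_right_mono[OF d v0] unfolding v_def[symmetric] by (simp add: mult.commute)
  consider "w \<le> (29 / 125)" | "(29 / 125) \<le> w" "w \<le> (43 / 100)" | "(43 / 100) \<le> w" "w \<le> 1 / 2" | "1 / 2 \<le> w" by linarith
  then show ?thesis
  proof cases
    case 1
    \<comment> \<open>The bound 29/125 is just below the cube root of
      \<open>1/80 = 1/2 - 3 * 13/80\<close>.\<close>
    then have "w ^ 3 \<le> (29 / 125) ^ 3" using w0 by (intro power_mono)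
    then show ?thesis using GAw y3 by (simp add: power3_eq_cube)
  next
    case 2
    \<comment> \<open>Near \<open>r = sqrt 2 - 1\<close> one has \<open>(1 - r)^2 = 2 * r^2\<close>,
      so the bound becomes proportional to \<open>\<eta> + 2 * \<delta>\<close>.\<close>
    have "y \<le> (207 / 500)\<^sup>2 * \<eta> + (1 - (207 / 500))\<^sup>2 * \<delta>" by (rule y2)
    then have "3 * y \<le> 5151 / 10000 * (\<eta> + 2 * \<delta>)" using nonneg by (simp add: power2_eq_square)
    moreover have "5151 / 10000 * (\<eta> + 2 * \<delta>) \<le> 5151 / 10000 * (1 - w\<^sup>2)"
      using total unfolding ww by (intro mult_left_mono) auto
    ultimately show ?thesis using cubic_gap[OF 2] GAw by linarith
  next
    case 3
    define u where "u = 1 - w"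
    have u: "w = 1 - u" "1 / 2 \<le> u" "u \<le> (57 / 100)" using 3 unfolding u_def by auto
    \<comment> \<open>The value \<open>u^2 * w\<close> belongs to a split into parts of proportions
      \<open>u\<close> and \<open>w\<close>, with bases inside the first and arcs from the first to
      the second; there \<open>v = u\<close>. For \<open>v \<le> u\<close> the codegree bound with
      \<open>r = w\<close> is nondecreasing in \<open>v\<close>. For larger \<open>v\<close> the
      bound \<open>y1'\<close> stays below its value at \<open>u\<close>.\<close>
    have "y \<le> u\<^sup>2 * w"
    proof (cases "v \<le> u")
      case True
      have "y \<le> w\<^sup>2 * v\<^sup>2 + u\<^sup>2 * ((1 - w\<^sup>2 - v\<^sup>2) / 2)"
        using y2[of w] mult_left_mono[OF d, of "u\<^sup>2"] unfolding vv u_def by simp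
      also have "\<dots> = u\<^sup>2 * (1 - w\<^sup>2) / 2 + v\<^sup>2 * (w\<^sup>2 - u\<^sup>2 / 2)" by (simp add: field_simps)
      also have "v\<^sup>2 * (w\<^sup>2 - u\<^sup>2 / 2) \<le> u\<^sup>2 * (w\<^sup>2 - u\<^sup>2 / 2)"
      proof (rule mult_right_mono)
        show "v\<^sup>2 \<le> u\<^sup>2" using True v0 by (intro power_mono)
        have "u\<^sup>2 \<le> (57 / 100)\<^sup>2" "(43 / 100)\<^sup>2 \<le> w\<^sup>2" using u 3 by (intro power_mono; simp)+
        then show "0 \<le> w\<^sup>2 - u\<^sup>2 / 2" by (simp add: power2_eq_square)
      qed
      also have "u\<^sup>2 * (1 - w\<^sup>2) / 2 + u\<^sup>2 * (w\<^sup>2 - u\<^sup>2 / 2) = u\<^sup>2 * w"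
        unfolding u(1) by (simp add: power2_eq_square field_simps)
      finally show ?thesis by simp
    next
      case False
      then have "u * u \<le> v * v" "u * u \<le> u * v" using u by (auto intro: mult_mono)
      moreover have "0 \<le> u * (3 * u - (2 - u))" using u by (intro mult_nonneg_nonneg) auto
      ultimately have "0 \<le> v * v + u * v + u * u - u * (2 - u)"
        by (simp add: algebra_simps)
      then have "0 \<le> (v - u) * (v * v + u * v + u * u - u * (2 - u))"
        using False by (intro mult_nonneg_nonneg) auto
      then have "v * (1 - w\<^sup>2 - v\<^sup>2) \<le> u * (1 - w\<^sup>2 - u\<^sup>2)"
        unfolding u(1) by (simp add: power2_eq_square algebra_simps)
      also have "\<dots> = 2 * (u\<^sup>2 * w)" unfolding u(1) by (simp add: power2_eq_square algebra_simps)
      finally show ?thesis using y1' by simp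
    qed
    then have "3 * y + G + A \<le> 3 * (u\<^sup>2 * w) + w ^ 3" using GAw by linarith
    also have "\<dots> = 1 / 2 - 4 * (1 / 2 - w) ^ 3"
      unfolding u_def by (simp add: power2_eq_square power3_eq_cube field_simps)
    also have "\<dots> \<le> 1 / 2" using 3 by simp
    finally show ?thesis .
  next
    case 4
    \<comment> \<open>This \<open>p\<close> maximises \<open>v * (1 - w^2 - v^2) / 2\<close> over
      \<open>v \<ge> 0\<close>, with maximum \<open>p^3\<close>.\<close>
    define p where "p = sqrt ((1 - w\<^sup>2) / 3)"
    have "w\<^sup>2 \<le> 1" using total nonneg unfolding ww by linarith
    then have p0: "0 \<le> p" and pp: "3 * p\<^sup>2 = 1 - w\<^sup>2" unfolding p_def by simp_all
    have "(1 / 2)\<^sup>2 \<le> w\<^sup>2" using 4 by (intro power_mono) auto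
    then have "p\<^sup>2 \<le> (1 / 2)\<^sup>2" using pp by (simp add: power2_eq_square)
    then have p: "p \<le> 1 / 2" by (rule power2_le_imp_le) simp
    have "0 \<le> (v - p)\<^sup>2 * (v + 2 * p)" using v0 p0 by simp
    then have "v * (3 * p\<^sup>2 - v\<^sup>2) / 2 \<le> p ^ 3"
      by (simp add: power2_eq_square power3_eq_cube algebra_simps)
    then have yp: "y \<le> p ^ 3" using y1' unfolding pp[symmetric] by linarith
    have A': "A \<le> 1 / 3 - \<gamma> / 3 - p\<^sup>2" using A pp ww by linarith
    show ?thesis
    \<comment> \<open>For large \<open>\<gamma>\<close> the balance \<open>G \<le> y\<close> is
      better and leaves a function of \<open>p\<close> alone. Otherwise \<open>G \<le> g^3\<close>
      separates the sum into a part in \<open>p\<close> and a part in \<open>g\<close>, each bounded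
      by its value at 1/2.\<close>
    proof (cases "1 / 4 \<le> \<gamma>")
      case True
      have "p\<^sup>2 * (4 * p - 1) \<le> 1 / 4"
      proof (cases "4 * p - 1 \<le> 0")
        case True
        then have "p\<^sup>2 * (4 * p - 1) \<le> 0" by (intro mult_nonneg_nonpos) auto
        then show ?thesis by simp
      next
        case False
        then have "p\<^sup>2 * (4 * p - 1) \<le> (1 / 2)\<^sup>2 * 1"
          using p p0 by (intro mult_mono power_mono) auto
        then show ?thesis by (simp add: power2_eq_square)
      qed
      then have "4 * p ^ 3 - p\<^sup>2 \<le> 1 / 4"
        by (simp add: power2_eq_square power3_eq_cube algebra_simps)
      then show ?thesis using yp Gy A' True by linarith
    next
      case False
      define g where "g = sqrt \<gamma>"
      have g0: "0 \<le> g" and gg: "g\<^sup>2 = \<gamma>" unfolding g_def using nonneg by simp_all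
      have "g\<^sup>2 \<le> (1 / 2)\<^sup>2" using False unfolding gg by (simp add: power2_eq_square)
      then have g: "g \<le> 1 / 2" by (rule power2_le_imp_le) simp
      have Gg: "G \<le> g ^ 3" using G g0 unfolding g_def[symmetric] gg[symmetric]
        by (simp add: power2_eq_square power3_eq_cube)
      have 1: "g\<^sup>2 * (g - 1 / 3) \<le> 1 / 24"
      proof (cases "g - 1 / 3 \<le> 0")
        case True
        then have "g\<^sup>2 * (g - 1 / 3) \<le> 0" by (intro mult_nonneg_nonpos) auto
        then show ?thesis by simp
      next
        case False
        then have "g\<^sup>2 * (g - 1 / 3) \<le> (1 / 2)\<^sup>2 * (1 / 6)"
          using g g0 by (intro mult_mono power_mono) auto
        then show ?thesis by (simp add: power2_eq_square)
      qed
      have 2: "p\<^sup>2 * (3 * p - 1) \<le> 1 / 8"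
      proof (cases "3 * p - 1 \<le> 0")
        case True
        then have "p\<^sup>2 * (3 * p - 1) \<le> 0" by (intro mult_nonneg_nonpos) auto
        then show ?thesis by simp
      next
        case False
        then have "p\<^sup>2 * (3 * p - 1) \<le> (1 / 2)\<^sup>2 * (1 / 2)"
          using p p0 by (intro mult_mono power_mono) auto
        then show ?thesis by (simp add: power2_eq_square)
      qed
      from 1 have "g ^ 3 - g\<^sup>2 / 3 \<le> 1 / 24"
        by (simp add: power2_eq_square power3_eq_cube algebra_simps)
      moreover from 2 have "3 * p ^ 3 - p\<^sup>2 \<le> 1 / 8"
        by (simp add: power2_eq_square power3_eq_cube algebra_simps)
      ultimately show ?thesis using yp Gg A' unfolding gg by linarith
    qed
  qed
qed

subsection \<open>Degrees\<close>

lemma four_graph_distinct: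
  assumes "four_graph V E" "{a, b, c, d} \<in> E"
  shows "distinct [a, b, c, d]" "a \<in> V" "b \<in> V" "c \<in> V" "d \<in> V"
proof -
  have c: "card {a, b, c, d} = 4" and sub: "{a, b, c, d} \<subseteq> V"
    using assms unfolding four_graph_def by auto
  have "card (set [a, b, c, d]) = length [a, b, c, d]" using c by simp
  then show "distinct [a, b, c, d]" by (rule card_distinct)
  show "a \<in> V" "b \<in> V" "c \<in> V" "d \<in> V" using sub by auto
qed

lemma four_graph_finite: "four_graph V E \<Longrightarrow> finite E"
  unfolding four_graph_def by (rule finite_subset[of _ "Pow V"]) auto

lemma pointed_edge: "pointed E b c d a \<Longrightarrow> {a, b, c, d} \<in> E"
  unfolding pointed_def by (simp add: insert_commute)

lemma twinless_edge: "twinless E a b c d \<Longrightarrow> {a, b, c, d} \<in> E"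
  unfolding twinless_def by blast

text \<open>A pointed or twinless shape is counted in all 6 orders of its link triangle, a cherry
  only in the 2 orders of its base; the factor 3 evens this out.\<close>

lemma degree_decomposition:
  assumes V: "four_graph V E" and nf: "no_full E"
  shows "6 * card {e \<in> E. a \<in> e} \<le> 3 * card {(b, c, d). cherry E a b c d}
    + card {(b, c, d). pointed E b c d a} + card {(b, c, d). twinless E a b c d}"
proof -
  define X where "X = V - {a}"
  define F where "F = {e \<in> E. a \<in> e}"
  define ed where "ed = (\<lambda>(b, c, d). {a, b, c, d})"
  have fF: "finite F" unfolding F_def using four_graph_finite[OF V] by simp
  have fX: "finite X" using V unfolding X_def four_graph_def by simp
  have count: "finite P \<and> card P = (\<Sum>e\<in>F. card {t \<in> P. ed t = e})"
    if P: "\<And>b c d. (b, c, d) \<in> P \<Longrightarrow> {a, b, c, d} \<in> E" for P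
  proof
    have "P \<subseteq> V \<times> V \<times> V" using four_graph_distinct[OF V P] by auto
    then show fP: "finite P" using V unfolding four_graph_def
      by (auto intro: finite_subset[OF _ finite_cartesian_product])
    have "ed ` P \<subseteq> F" using P unfolding ed_def F_def by auto
    from sum.group[OF fP fF this, of "\<lambda>_. 1 :: nat"] show "card P = (\<Sum>e\<in>F. card {t \<in> P. ed t = e})"
      by simp
  qed
  let ?C = "{(b, c, d). cherry E a b c d}" and ?G = "{(b, c, d). pointed E b c d a}"
    and ?A = "{(b, c, d). twinless E a b c d}"
  have "finite ?C \<and> card ?C = (\<Sum>e\<in>F. card {t \<in> ?C. ed t = e})"
    by (rule count) (simp add: cherry_edge)
  then have C: "finite ?C" "card ?C = (\<Sum>e\<in>F. card {t \<in> ?C. ed t = e})" by blast+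
  have "finite ?G \<and> card ?G = (\<Sum>e\<in>F. card {t \<in> ?G. ed t = e})"
    by (rule count) (simp add: pointed_edge)
  then have G: "finite ?G" "card ?G = (\<Sum>e\<in>F. card {t \<in> ?G. ed t = e})" by blast+
  have "finite ?A \<and> card ?A = (\<Sum>e\<in>F. card {t \<in> ?A. ed t = e})"
    by (rule count) (simp add: twinless_edge)
  then have A: "finite ?A" "card ?A = (\<Sum>e\<in>F. card {t \<in> ?A. ed t = e})" by blast+
  have each: "6 \<le> 3 * card {t \<in> ?C. ed t = e} + card {t \<in> ?G. ed t = e} + card {t \<in> ?A. ed t = e}"
    if e: "e \<in> F" for e
  proof -
    have "card (e - {a}) = 3" using e V unfolding F_def four_graph_def by (auto simp: card_Diff_singleton)
    then obtain b c d where bcd: "e - {a} = {b, c, d}" unfolding card_3_iff by blast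
    then have e': "e = {a, b, c, d}" using e unfolding F_def by auto
    then have E: "{a, b, c, d} \<in> E" using e unfolding F_def by simp
    have ds: "distinct [a, b, c, d]" using four_graph_distinct[OF V E] by blast
    have ch: "2 \<le> card {t \<in> ?C. ed t = e}" if "cherry E a x y z" "e = {a, x, y, z}" "x \<noteq> y" for x y z
    proof -
      have "{(x, y, z), (y, x, z)} \<subseteq> {t \<in> ?C. ed t = e}"
        using that cherry_commute[of E a x y z] unfolding ed_def by auto
      from card_mono[OF _ this] C(1) that(3) show ?thesis by simp
    qed
    have perms: "card {(b, c, d), (b, d, c), (c, b, d), (c, d, b), (d, b, c), (d, c, b)} = 6"
      using ds by auto
    consider "cherry E a b c d" | "cherry E a c d b" | "cherry E a b d c" | "pointed E b c d a" | "twinless E a b c d"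
      using edge_types[OF E nf] by blast
    then show ?thesis
    proof cases
      case 1
      moreover have "e = {a, b, c, d}" "b \<noteq> c" using e' ds by auto
      ultimately have "2 \<le> card {t \<in> ?C. ed t = e}" by (rule ch)
      then show ?thesis by linarith
    next
      case 2
      moreover have "e = {a, c, d, b}" "c \<noteq> d" using e' ds by auto
      ultimately have "2 \<le> card {t \<in> ?C. ed t = e}" by (rule ch)
      then show ?thesis by linarith
    next
      case 3
      moreover have "e = {a, b, d, c}" "b \<noteq> d" using e' ds by auto
      ultimately have "2 \<le> card {t \<in> ?C. ed t = e}" by (rule ch)
      then show ?thesis by linarith
    next
      case 4
      have "{(b, c, d), (b, d, c), (c, b, d), (c, d, b), (d, b, c), (d, c, b)} \<subseteq> {t \<in> ?G. ed t = e}"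
        using pointed_perm[OF 4] 4 unfolding ed_def e' by auto
      from card_mono[OF _ this] G(1) perms show ?thesis by simp
    next
      case 5
      have t: "twinless E a b d c" "twinless E a c b d" "twinless E a c d b" "twinless E a d b c" "twinless E a d c b"
        using twinless_perm(3)[OF 5] twinless_perm(2)[OF 5] twinless_perm(3)[OF twinless_perm(2)[OF 5]]
          twinless_perm(2)[OF twinless_perm(3)[OF 5]] twinless_perm(2)[OF twinless_perm(3)[OF twinless_perm(2)[OF 5]]]
        by simp_all
      have "{(b, c, d), (b, d, c), (c, b, d), (c, d, b), (d, b, c), (d, c, b)} \<subseteq> {t \<in> ?A. ed t = e}"
        using 5 t unfolding ed_def e' by auto
      from card_mono[OF _ this] A(1) perms show ?thesis by simp
    qed
  qed
  have "6 * card F = (\<Sum>e\<in>F. 6)" by simp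
  also have "\<dots> \<le> (\<Sum>e\<in>F. 3 * card {t \<in> ?C. ed t = e} + card {t \<in> ?G. ed t = e} + card {t \<in> ?A. ed t = e})"
    using each by (intro sum_mono)
  also have "\<dots> = 3 * card ?C + card ?G + card ?A"
    unfolding C(2) G(2) A(2) by (simp add: sum.distrib sum_distrib_left)
  finally show ?thesis unfolding F_def .
qed

text \<open>Dividing pair counts by \<open>N^2\<close> and triple counts by \<open>N^3\<close> gives
  densities to which \<open>density_bound\<close> applies; the bound 1/2 is then divided by the 6
  orders of a link triangle.\<close>

lemma link_bound:
  assumes V: "four_graph V E" and nf: "no_full E" and a: "a \<in> V"
    and bal: "card {(b, c, d). pointed E b c d a} \<le> card {(b, c, d). pointed E a b c d}"
  shows "real (card {e \<in> E. a \<in> e}) \<le> real (card V - 1) ^ 3 / 12"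
proof (cases "{e \<in> E. a \<in> e} = {}")
  case True
  show ?thesis unfolding True by simp
next
  case False
  define X where "X = V - {a}"
  define N where "N = real (card X)"
  define C G A where "C = {(b, c, d). cherry E a b c d}" and "G = {(b, c, d). pointed E b c d a}"
    and "A = {(b, c, d). twinless E a b c d}"
  define R S T B where "R = {(b, c). base E a b c}" and "S = {(b, c). arc E a b c}"
    and "T = {(b, c). apex E a b c}" and "B = {(b, c). bare E a b c}"
  have fX: "finite X" using V unfolding X_def four_graph_def by simp
  have X: "b \<in> X \<and> c \<in> X \<and> d \<in> X \<and> b \<noteq> c" if "{a, b, c, d} \<in> E" for b c d
    using four_graph_distinct[OF V that] unfolding X_def by auto
  have sub: "C \<subseteq> X \<times> X \<times> X" "G \<subseteq> X \<times> X \<times> X" "A \<subseteq> X \<times> X \<times> X"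
    unfolding C_def G_def A_def using X[OF cherry_edge] X[OF pointed_edge] X[OF twinless_edge] by auto
  have cb: "cherry E a b c d \<Longrightarrow> base E a b c \<and> arc E a b d \<and> arc E a c d" for b c d
    unfolding base_def arc_def using cherry_commute[of E a b c d] by blast
  have sub2: "R \<subseteq> X \<times> X" "S \<subseteq> X \<times> X" "T \<subseteq> X \<times> X" "B \<subseteq> X \<times> X"
    unfolding R_def S_def T_def B_def base_def arc_def apex_def bare_def
    using X[OF cherry_edge] X[OF pointed_edge] X[OF twinless_edge] by auto
  have N0: "0 < N"
  proof -
    obtain e where "e \<in> E" "a \<in> e" using False by blast
    then have "card (e - {a}) = 3" "e - {a} \<subseteq> X"
      using V unfolding four_graph_def X_def by (auto simp: card_Diff_singleton)
    then have "3 \<le> card X" using card_mono[OF fX] by metis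
    then show ?thesis unfolding N_def by simp
  qed
  note ex = link_exclusive[OF nf, of a]
  \<comment> \<open>All sets consist of ordered pairs. The arcs and their converses are disjoint,
    which gives \<open>S\<close> its factor 2.\<close>
  have total: "real (card R) + 2 * real (card S) + real (card T) + real (card B) \<le> N\<^sup>2"
  proof -
    have fin: "finite R" "finite S" "finite (S\<inverse>)" "finite T" "finite B" "S\<inverse> \<subseteq> X \<times> X"
      using sub2 fX by (auto intro: finite_subset[OF _ finite_cartesian_product])
    have d: "R \<inter> S = {}" "(R \<union> S) \<inter> S\<inverse> = {}" "(R \<union> S \<union> S\<inverse>) \<inter> T = {}"
      "(R \<union> S \<union> S\<inverse> \<union> T) \<inter> B = {}"
      unfolding R_def S_def T_def B_def using ex by auto
    have "card R + 2 * card S + card T + card B = card (R \<union> S \<union> S\<inverse> \<union> T \<union> B)"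
      using fin d by (simp add: card_Un_disjoint)
    also have "\<dots> \<le> card (X \<times> X)" using fX sub2 fin by (intro card_mono) auto
    finally have "card R + 2 * card S + card T + card B \<le> card X * card X"
      by (simp add: card_cartesian_product)
    then have "real (card R + 2 * card S + card T + card B) \<le> real (card X * card X)"
      by (simp only: of_nat_le_iff)
    then show ?thesis unfolding N_def by (simp add: power2_eq_square)
  qed
  interpret mixed_graph "base E a" "arc E a"
  proof
    show "base E a x y \<Longrightarrow> base E a y x" for x y by (simp add: base_commute[of E a y x])
    show "\<not> base E a x x" for x unfolding base_def using X[OF cherry_edge] by blast
    show "arc E a x y \<Longrightarrow> \<not> arc E a y x" for x y using ex by blast
    show "base E a x y \<Longrightarrow> \<not> arc E a x y" for x y using ex by blast
  qed
  have y3: "real (card C) \<le> 13 / 80 * N ^ 3"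
  proof -
    have "C \<subseteq> cherries (base E a) (arc E a) X"
      using sub(1) cb unfolding cherries_def C_def by auto
    moreover have "finite (cherries (base E a) (arc E a) X)"
      by (rule finite_subset[of _ "X \<times> X \<times> X"]) (use fX in \<open>auto simp: cherries_def\<close>)
    ultimately have "card C \<le> card (cherries (base E a) (arc E a) X)" by (rule card_mono[rotated])
    then show ?thesis using card_cherries_le[OF fX] unfolding N_def by linarith
  qed
  have y1: "real (card C) \<le> real (card S) * sqrt (real (card R))"
    by (rule triple_bound[OF fX sub(1) sub2(1,2)]) (use cb in \<open>auto simp: C_def R_def S_def\<close>)
  have y2: "real (card C) \<le> N * (r\<^sup>2 * real (card R) + (1 - r)\<^sup>2 * real (card S))" for r
    unfolding N_def
    by (rule codegree_bound[OF fX sub(1) sub2(1,2)]) (use cb ex in \<open>auto simp: C_def R_def S_def\<close>)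
  have ap: "(b, c) \<in> T \<and> (b, d) \<in> T \<and> (c, d) \<in> T" if "(b, c, d) \<in> G" for b c d
    using that pointed_perm(2,3)[of E b c d a] unfolding G_def T_def apex_def by blast
  have br: "(b, c) \<in> B \<and> (b, d) \<in> B \<and> (c, d) \<in> B" if "(b, c, d) \<in> A" for b c d
  proof -
    have t: "twinless E a b c d" using that unfolding A_def by simp
    then have "twinless E a b d c" by (rule twinless_perm(3))
    moreover have "twinless E a c d b" using twinless_perm(3)[OF twinless_perm(2)[OF t]] .
    ultimately show ?thesis using t unfolding B_def bare_def by blast
  qed
  have g: "real (card G) \<le> real (card T) * sqrt (real (card T))"
    by (rule triple_bound[OF fX sub(2) sub2(3,3)]) (use ap in blast)
  have ga: "real (card G) + real (card A) \<le> (real (card T) + real (card B)) * sqrt (real (card T) + real (card B))"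
  proof -
    have "G \<inter> A = {}" using types_exclusive(4)[OF nf] unfolding G_def A_def by auto
    moreover have "finite G" "finite A" using sub fX
      by (auto intro: finite_subset[OF _ finite_cartesian_product])
    ultimately have 1: "card (G \<union> A) = card G + card A" by (simp add: card_Un_disjoint)
    have "T \<inter> B = {}" unfolding T_def B_def using ex by auto
    moreover have "finite T" "finite B" using sub2 fX
      by (auto intro: finite_subset[OF _ finite_cartesian_product])
    ultimately have 2: "card (T \<union> B) = card T + card B" by (simp add: card_Un_disjoint)
    have "real (card (G \<union> A)) \<le> real (card (T \<union> B)) * sqrt (real (card (T \<union> B)))"
    proof (rule triple_bound[OF fX])
      show "G \<union> A \<subseteq> X \<times> X \<times> X" using sub by simp
      show "T \<union> B \<subseteq> X \<times> X" "T \<union> B \<subseteq> X \<times> X" using sub2 by simp_all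
    qed (use ap br in blast)
    then show ?thesis unfolding 1 2 by simp
  qed
  have al: "3 * real (card A) \<le> N * real (card B)"
    unfolding N_def
  proof (rule rotation_bound[OF fX sub(3) sub2(4)])
    show "(b, c) \<in> B" if "(b, c, d) \<in> A" for b c d using br[OF that] by blast
    show "(c, d, b) \<in> A" if "(b, c, d) \<in> A" for b c d
      using twinless_perm(3)[OF twinless_perm(2), of E a b c d] that unfolding A_def by simp
    show False if "(b, c, d) \<in> A" "(b, c, e) \<in> A" "(c, d, e) \<in> A" for b c d e
      using twinless_codegree[of E a b c d e] that unfolding A_def by simp
  qed
  \<comment> \<open>Edges pointed away from \<open>a\<close> are cherries in its link, so the
    balance assumption bounds \<open>G\<close> by \<open>C\<close>.\<close>
  have gy: "card G \<le> card C"
  proof -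
    have "card {(b, c, d). pointed E a b c d} \<le> card C"
      using sub(1) fX unfolding C_def cherry_def
      by (intro card_mono) (auto intro: finite_subset[OF _ finite_cartesian_product])
    then show ?thesis using bal unfolding G_def by linarith
  qed
  have scale: "p / N ^ 3 \<le> s / N\<^sup>2 * sqrt (t / N\<^sup>2)" if "p \<le> s * sqrt t" for p s t
  proof -
    have "s / N\<^sup>2 * sqrt (t / N\<^sup>2) = s * sqrt t / N ^ 3"
      using N0 by (simp add: real_sqrt_divide power2_eq_square power3_eq_cube)
    then show ?thesis using that N0 by (simp add: divide_right_mono)
  qed
  have "3 * (real (card C) / N ^ 3) + real (card G) / N ^ 3 + real (card A) / N ^ 3 \<le> 1 / 2"
  proof (rule density_bound[where \<eta> = "real (card R) / N\<^sup>2" and \<delta> = "real (card S) / N\<^sup>2"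
        and \<gamma> = "real (card T) / N\<^sup>2" and \<zeta> = "real (card B) / N\<^sup>2"])
    show "real (card R) / N\<^sup>2 + 2 * (real (card S) / N\<^sup>2) + real (card T) / N\<^sup>2 + real (card B) / N\<^sup>2 \<le> 1"
      using total N0 by (simp add: field_simps)
    show "real (card C) / N ^ 3 \<le> real (card S) / N\<^sup>2 * sqrt (real (card R) / N\<^sup>2)"
      using y1 by (rule scale)
    show "real (card C) / N ^ 3 \<le> r\<^sup>2 * (real (card R) / N\<^sup>2) + (1 - r)\<^sup>2 * (real (card S) / N\<^sup>2)" for r
    proof -
      have "real (card C) / N ^ 3 \<le> N * (r\<^sup>2 * real (card R) + (1 - r)\<^sup>2 * real (card S)) / N ^ 3"
        using y2[of r] N0 by (intro divide_right_mono) auto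
      also have "\<dots> = r\<^sup>2 * (real (card R) / N\<^sup>2) + (1 - r)\<^sup>2 * (real (card S) / N\<^sup>2)"
        using N0 by (simp add: power2_eq_square power3_eq_cube add_divide_distrib)
      finally show ?thesis .
    qed
    show "real (card C) / N ^ 3 \<le> 13 / 80" using y3 N0 by (simp add: field_simps)
    show "real (card G) / N ^ 3 \<le> real (card C) / N ^ 3" using gy N0 by (simp add: divide_right_mono)
    show "real (card G) / N ^ 3 \<le> real (card T) / N\<^sup>2 * sqrt (real (card T) / N\<^sup>2)"
      using g by (rule scale)
    show "real (card G) / N ^ 3 + real (card A) / N ^ 3
      \<le> (real (card T) / N\<^sup>2 + real (card B) / N\<^sup>2) * sqrt (real (card T) / N\<^sup>2 + real (card B) / N\<^sup>2)"
      using ga unfolding add_divide_distrib[symmetric] by (rule scale)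
    show "real (card A) / N ^ 3 \<le> real (card B) / N\<^sup>2 / 3"
      using al N0 by (simp add: field_simps power2_eq_square power3_eq_cube)
  qed (use N0 in auto)
  then have "3 * real (card C) + real (card G) + real (card A) \<le> N ^ 3 / 2"
    using N0 by (simp add: field_simps)
  moreover have "real (6 * card {e \<in> E. a \<in> e}) \<le> real (3 * card C + card G + card A)"
    using degree_decomposition[OF V nf, of a] unfolding C_def G_def A_def by (simp only: of_nat_le_iff)
  moreover have "N = real (card V - 1)" using a unfolding N_def X_def by simp
  ultimately show ?thesis by simp
qed

text \<open>Both sides, summed over \<open>a\<close>, count all pointed orderings of edges.\<close>

lemma exists_balanced:
  assumes V: "four_graph V E" and ne: "V \<noteq> {}"
  shows "\<exists>a\<in>V. card {(b, c, d). pointed E b c d a} \<le> card {(b, c, d). pointed E a b c d}"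
proof (rule ccontr)
  assume "\<not> ?thesis"
  then have "(\<Sum>a\<in>V. card {(b, c, d). pointed E a b c d}) < (\<Sum>a\<in>V. card {(b, c, d). pointed E b c d a})"
    using V ne unfolding four_graph_def by (intro sum_strict_mono) auto
  moreover have inV: "a \<in> V \<and> b \<in> V \<and> c \<in> V \<and> d \<in> V" if "pointed E a b c d" for a b c d
    using four_graph_distinct[OF V] that unfolding pointed_def by blast
  have fV: "finite V" using V unfolding four_graph_def by blast
  have fin: "finite {(b, c, d). pointed E a b c d}" "finite {(b, c, d). pointed E b c d a}" for a
    by (rule finite_subset[of _ "V \<times> V \<times> V"]; use fV inV in auto)+
  have "(\<Sum>a\<in>V. card {(b, c, d). pointed E a b c d}) = card (SIGMA a:V. {(b, c, d). pointed E a b c d})"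
    using fV fin by (simp add: card_SigmaI)
  also have "\<dots> = card (SIGMA a:V. {(b, c, d). pointed E b c d a})"
    by (rule bij_betw_same_card[of "\<lambda>(a, b, c, d). (d, a, b, c)"],
        rule bij_betw_byWitness[where f'="\<lambda>(d, a, b, c). (a, b, c, d)"]) (use inV in auto)
  also have "\<dots> = (\<Sum>a\<in>V. card {(b, c, d). pointed E b c d a})"
    using fV fin by (simp add: card_SigmaI)
  ultimately show False by simp
qed

section \<open>Induction on the number of vertices\<close>

lemma C1_hom_free_mono:
  assumes "C1_hom_free V E" "V' \<subseteq> V" "E' \<subseteq> E"
  shows "C1_hom_free V' E'"
  using assms unfolding C1_hom_free_def tight_cycle_hom_def by blast

theorem theorem5p7:
  fixes V :: "'a set" and E :: "'a set set" and n :: nat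
  assumes "four_graph V E" and "card V = n" and "n \<ge> 1"
    and "C1_hom_free V E"
  shows "real (card E) < real n ^ 4 / 48"
  using assms(3,1,2,4)
proof (induction n arbitrary: V E rule: nat_induct_at_least)
  case base
  \<comment> \<open>A single vertex carries no edge. The strict inequality originates here and is
    passed on by the induction.\<close>
  have "E = {}"
  proof (rule ccontr)
    assume "E \<noteq> {}"
    then obtain e where "e \<subseteq> V" "card e = 4" using base(1) unfolding four_graph_def by blast
    then show False using base(1,2) card_mono[of V e] unfolding four_graph_def by simp
  qed
  then show ?case by simp
next
  case (Suc m)
  note V = Suc.prems(1)
  have fV: "finite V" and ne: "V \<noteq> {}" using V Suc.prems(2) unfolding four_graph_def by auto
  obtain a where a: "a \<in> V"
    and bal: "card {(b, c, d). pointed E b c d a} \<le> card {(b, c, d). pointed E a b c d}"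
    using exists_balanced[OF V ne] by blast
  define E' where "E' = {e \<in> E. a \<notin> e}"
  have "four_graph (V - {a}) E'" using V unfolding four_graph_def E'_def by auto
  moreover have "card (V - {a}) = m" using a fV Suc.prems(2) by simp
  moreover have "C1_hom_free (V - {a}) E'"
    by (rule C1_hom_free_mono[OF Suc.prems(3)]) (auto simp: E'_def)
  ultimately have IH: "real (card E') < real m ^ 4 / 48" by (rule Suc.IH)
  have link: "real (card {e \<in> E. a \<in> e}) \<le> real m ^ 3 / 12"
    using link_bound[OF V hom_free_no_full[OF V Suc.prems(3)] a bal] Suc.prems(2) by simp
  have "E = E' \<union> {e \<in> E. a \<in> e}" "E' \<inter> {e \<in> E. a \<in> e} = {}" unfolding E'_def by auto
  then have "card E = card E' + card {e \<in> E. a \<in> e}"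
    using four_graph_finite[OF V] by (metis card_Un_disjoint finite_Un)
  then have "real (card E) < real m ^ 4 / 48 + real m ^ 3 / 12" using IH link by simp
  also have "\<dots> \<le> real (Suc m) ^ 4 / 48"
    by (simp add: power4_eq_xxxx power3_eq_cube field_simps)
  finally show ?case .
qed

end
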